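(* Let $H$ be a norming graph. Then the graphon parameter $t(H,\cdot)$ is cut distance identifying, that is, for any two graphons $W_1,W_2$ with $W_1\prec W_2$ we have $t(H,W_1)<t(H,W_2)$. In particular, $H$ is step forcing, i.e. $t(H,W^{\Join\mathcal P})<t(H,W)$ for each graphon $W$ and each finite partition $\mathcal P$ of $\Omega$ for which $W\ne W^{\Join\mathcal P}$.
   Context: $\Omega$ is a standard Borel space with an atomless probability measure $\nu$. A kernel is a bounded symmetric measurable function $\Omega^2\to\mathbb R$, and a graphon is a kernel with values in $[0,1]$; both are considered modulo null sets. For a measure preserving bijection $\varphi:\Omega\to\Omega$ put $W^\varphi(x,y)=W(\varphi(x),\varphi(y))$. Graphons $\Gamma_n$ converge weak* to $W$ if $\int_{S\times T}\Gamma_n\to\int_{S\times T}W$ for all measurable $S,T\subset\Omega$. The envelope $\langle W\rangle$ is the set of all graphons $U$ for which there are measure preserving bijections $\pi_1,\pi_2,\ldots$ of $\Omega$ with $W^{\pi_n}\to U$ weak*. Write $U\preceq W$ if $\langle U\rangle\subset\langle W\rangle$, and $U\prec W$ if $U\preceq W$ but not $W\preceq U$. For a finite simple graph $H$ on vertices $v_1,\dots,v_n$ and a kernel $W$, $t(H,W)=\int_{\Omega^n}\prod_{v_iv_j\in E(H)}W(x_i,x_j)\,\mathrm d\nu^{\otimes n}$. $H$ is norming if $\|W\|_H:=|t(H,W)|^{1/e(H)}$ is a norm on the space of all kernels (modulo null sets), where $e(H)=|E(H)|$. For a finite (measurable) partition $\mathcal P=\{\Omega_1,\dots,\Omega_k\}$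 of $\Omega$, $W^{\Join\mathcal P}$ is the graphon that is constant on each $\Omega_i\times\Omega_j$, equal there to the average of $W$ on $\Omega_i\times\Omega_j$. *)

theory Defs
  imports "HOL-Probability.Probability"
begin

section \<open>The underlying probability space\<close>

definition standard_borel :: "'a measure \<Rightarrow> bool" where
  "standard_borel M \<longleftrightarrow>
     (\<exists>X. topspace X = space M \<and> completely_metrizable_space X \<and> separable_space X \<and>
          sets M = sigma_sets (topspace X) {U. openin X U})"

definition atomless :: "'a measure \<Rightarrow> bool" where
  "atomless M \<longleftrightarrow>
     (\<forall>A\<in>sets M. emeasure M A > 0 \<longrightarrow>
        (\<exists>B\<in>sets M. B \<subseteq> A \<and> 0 < emeasure M B \<and> emeasure M B < emeasure M A))"

text \<open>
  An automorphism of the measure space. On a standard Borel space the measurability of the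
  inverse follows from the other conditions, by the Lusin--Souslin theorem.
\<close>

definition mp_bij :: "'a measure \<Rightarrow> ('a \<Rightarrow> 'a) \<Rightarrow> bool" where
  "mp_bij M \<phi> \<longleftrightarrow>
     bij_betw \<phi> (space M) (space M) \<and> \<phi> \<in> measurable M M \<and>
     the_inv_into (space M) \<phi> \<in> measurable M M \<and> distr M M \<phi> = M"


section \<open>Kernels and graphons\<close>

text \<open>
  Kernels and graphons are represented by functions, not by equivalence classes; equality
  modulo null sets is written out as \<open>AE\<close> with respect to the product measure where it matters.
\<close>

definition kernel :: "'a measure \<Rightarrow> ('a \<times> 'a \<Rightarrow> real) \<Rightarrow> bool" where
  "kernel M W \<longleftrightarrow>
     W \<in> borel_measurable (M \<Otimes>\<^sub>M M) \<and>
     (\<exists>C. \<forall>x\<in>space M. \<forall>y\<in>space M. \<bar>W (x, y)\<bar> \<le> C) \<and>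
     (\<forall>x\<in>space M. \<forall>y\<in>space M. W (x, y) = W (y, x))"

definition graphon :: "'a measure \<Rightarrow> ('a \<times> 'a \<Rightarrow> real) \<Rightarrow> bool" where
  "graphon M W \<longleftrightarrow>
     kernel M W \<and> (\<forall>x\<in>space M. \<forall>y\<in>space M. 0 \<le> W (x, y) \<and> W (x, y) \<le> 1)"

definition pullback :: "('a \<Rightarrow> 'a) \<Rightarrow> ('a \<times> 'a \<Rightarrow> real) \<Rightarrow> 'a \<times> 'a \<Rightarrow> real" where
  "pullback \<phi> W = (\<lambda>(x, y). W (\<phi> x, \<phi> y))"

definition weak_star_conv ::
    "'a measure \<Rightarrow> (nat \<Rightarrow> 'a \<times> 'a \<Rightarrow> real) \<Rightarrow> ('a \<times> 'a \<Rightarrow> real) \<Rightarrow> bool" where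
  "weak_star_conv M \<Gamma> W \<longleftrightarrow>
     (\<forall>S\<in>sets M. \<forall>T\<in>sets M.
        (\<lambda>n. set_lebesgue_integral (M \<Otimes>\<^sub>M M) (S \<times> T) (\<Gamma> n))
          \<longlonglongrightarrow> set_lebesgue_integral (M \<Otimes>\<^sub>M M) (S \<times> T) W)"

definition envelope :: "'a measure \<Rightarrow> ('a \<times> 'a \<Rightarrow> real) \<Rightarrow> ('a \<times> 'a \<Rightarrow> real) set" where
  "envelope M W =
     {U. graphon M U \<and>
         (\<exists>\<pi>. (\<forall>n. mp_bij M (\<pi> n)) \<and> weak_star_conv M (\<lambda>n. pullback (\<pi> n) W) U)}"

definition struct_le :: "'a measure \<Rightarrow> ('a \<times> 'a \<Rightarrow> real) \<Rightarrow> ('a \<times> 'a \<Rightarrow> real) \<Rightarrow> bool" where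
  "struct_le M U W \<longleftrightarrow> envelope M U \<subseteq> envelope M W"

definition struct_less :: "'a measure \<Rightarrow> ('a \<times> 'a \<Rightarrow> real) \<Rightarrow> ('a \<times> 'a \<Rightarrow> real) \<Rightarrow> bool" where
  "struct_less M U W \<longleftrightarrow> struct_le M U W \<and> \<not> struct_le M W U"

text \<open>
  For a measurable partition \<open>P\<close> at most one summand is nonzero at each point. On
  rectangles of measure zero the value is \<open>0\<close>, because division by zero yields \<open>0\<close>.
\<close>

definition stepping :: "'a measure \<Rightarrow> 'a set set \<Rightarrow> ('a \<times> 'a \<Rightarrow> real) \<Rightarrow> 'a \<times> 'a \<Rightarrow> real" where
  "stepping M P W = (\<lambda>z. \<Sum>A\<in>P. \<Sum>B\<in>P.
     indicator (A \<times> B) z *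
       (set_lebesgue_integral (M \<Otimes>\<^sub>M M) (A \<times> B) W / (measure M A * measure M B)))"


section \<open>Graphs and homomorphism densities\<close>

text \<open>A finite simple graph with vertex set \<open>{..<n}\<close>; edges are two-element sets of vertices.\<close>

definition simple_graph :: "nat \<Rightarrow> nat set set \<Rightarrow> bool" where
  "simple_graph n E \<longleftrightarrow> (\<forall>e\<in>E. e \<subseteq> {..<n} \<and> card e = 2)"

text \<open>
  \<open>Min e\<close> and \<open>Max e\<close> are the two endpoints of \<open>e\<close>; their order is irrelevant for symmetric \<open>W\<close>.
\<close>

definition hom_density ::
    "'a measure \<Rightarrow> nat \<Rightarrow> nat set set \<Rightarrow> ('a \<times> 'a \<Rightarrow> real) \<Rightarrow> real" where
  "hom_density M n E W =
     (\<integral>x. (\<Prod>e\<in>E. W (x (Min e), x (Max e))) \<partial>(PiM {..<n} (\<lambda>_. M)))"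

text \<open>
  For an edgeless graph the exponent below is \<open>1 / 0 = 0\<close> and the functional is constantly \<open>1\<close>,
  so such a graph is not norming.
\<close>

definition graph_norm ::
    "'a measure \<Rightarrow> nat \<Rightarrow> nat set set \<Rightarrow> ('a \<times> 'a \<Rightarrow> real) \<Rightarrow> real" where
  "graph_norm M n E W = \<bar>hom_density M n E W\<bar> powr (1 / real (card E))"

definition norm_on_kernels :: "'a measure \<Rightarrow> (('a \<times> 'a \<Rightarrow> real) \<Rightarrow> real) \<Rightarrow> bool" where
  "norm_on_kernels M N \<longleftrightarrow>
     (\<forall>W. kernel M W \<longrightarrow> 0 \<le> N W) \<and>
     (\<forall>W. kernel M W \<longrightarrow> (N W = 0 \<longleftrightarrow> (AE z in M \<Otimes>\<^sub>M M. W z = 0))) \<and>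
     (\<forall>c W. kernel M W \<longrightarrow> N (\<lambda>z. c * W z) = \<bar>c\<bar> * N W) \<and>
     (\<forall>U W. kernel M U \<longrightarrow> kernel M W \<longrightarrow> N (\<lambda>z. U z + W z) \<le> N U + N W)"

definition norming :: "'a measure \<Rightarrow> nat \<Rightarrow> nat set set \<Rightarrow> bool" where
  "norming M n E \<longleftrightarrow> norm_on_kernels M (graph_norm M n E)"

definition cut_distance_identifying ::
    "'a measure \<Rightarrow> (('a \<times> 'a \<Rightarrow> real) \<Rightarrow> real) \<Rightarrow> bool" where
  "cut_distance_identifying M f \<longleftrightarrow>
     (\<forall>W\<^sub>1 W\<^sub>2. graphon M W\<^sub>1 \<longrightarrow> graphon M W\<^sub>2 \<longrightarrow> struct_less M W\<^sub>1 W\<^sub>2 \<longrightarrow> f W\<^sub>1 < f W\<^sub>2)"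

definition step_forcing :: "'a measure \<Rightarrow> nat \<Rightarrow> nat set set \<Rightarrow> bool" where
  "step_forcing M n E \<longleftrightarrow>
     (\<forall>W P. graphon M W \<longrightarrow> finite P \<longrightarrow> partition_on (space M) P \<longrightarrow> P \<subseteq> sets M \<longrightarrow>
        \<not> (AE z in M \<Otimes>\<^sub>M M. W z = stepping M P W z) \<longrightarrow>
        hom_density M n E (stepping M P W) < hom_density M n E W)"

end

theory Submission
  imports Defs
begin

text \<open>
  Along a segment \<open>U + t V\<close> the density \<open>t(H, \<cdot>)\<close> is a polynomial in \<open>t\<close> of degree at most \<open>e(H)\<close> whose
  coefficient at \<open>t\<^sup>e\<^sup>(\<^sup>H\<^sup>)\<close> is \<open>t(H, V)\<close>, which vanishes only for \<open>V = 0\<close>. Between graphons this polynomial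
  is convex, being a power of a norm. Thus \<open>t(H, \<cdot>)\<close> is strictly convex on graphons, in a form that passes to
  limits: if the polynomials on the segments from \<open>W\<close> to \<open>\<Gamma>\<^sub>k\<close> converge to a constant, then
  \<open>\<Gamma>\<^sub>k \<rightarrow> W\<close> in the norm.

  For a stepping \<open>U\<close> of \<open>W\<close> the linear coefficient on the segment from \<open>U\<close> to \<open>W\<close> is zero, because \<open>W - U\<close>
  integrates to zero over the cells on which \<open>U\<close> is constant. Hence \<open>U\<close> minimizes the density on the segment,
  strictly by convexity.

  If versions \<open>W\<^sub>2\<^sup>\<pi>\<close> converge weak* to \<open>W\<^sub>1\<close>, then weak* lower semicontinuity (Mazur's lemma) gives
  \<open>t(H, W\<^sub>1) \<le> t(H, W\<^sub>2)\<close>, and in the case of equality the convergence is in the norm. The norm is invariant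
  under measure preserving bijections, so then versions of \<open>W\<^sub>1\<close> approximate every weak* limit of versions of
  \<open>W\<^sub>2\<close>, that is, \<open>W\<^sub>2 \<preceq> W\<^sub>1\<close>.
\<close>

section \<open>Polynomials and Mazur-type limits\<close>

text \<open>Polynomials of bounded degree form a finite-dimensional space, so pointwise convergence
  on \<open>[0, 1]\<close> controls the coefficients. The induction eliminates the leading term and
  regains its coefficient from the value at 1.\<close>

lemma coeffs_tendsto_zero:
  fixes a :: "nat \<Rightarrow> nat \<Rightarrow> real"
  assumes "\<And>s. 0 \<le> s \<Longrightarrow> s \<le> 1 \<Longrightarrow> (\<lambda>k. \<Sum>j\<le>m. a k j * s ^ j) \<longlonglongrightarrow> 0"
    and "j \<le> m"
  shows "(\<lambda>k. a k j) \<longlonglongrightarrow> 0"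
  using assms
proof (induction m arbitrary: a j)
  case 0
  then show ?case
    using 0(1)[of 0] by simp
next
  case (Suc m)
  \<comment> \<open>The combination \<open>p(s) - 2\<^sup>m\<^sup>+\<^sup>1 p(s/2)\<close> cancels the leading term of \<open>p\<close>.\<close>
  define c where "c j = 1 - 2 ^ Suc m / (2::real) ^ j" for j
  have c_nz: "c j \<noteq> 0" if "j \<le> m" for j
  proof -
    have "(2::real) ^ j < 2 ^ Suc m"
      using that by (intro power_strict_increasing) auto
    then show ?thesis by (simp add: c_def divide_simps)
  qed
  have c_top: "c (Suc m) = 0" by (simp add: c_def)
  have low: "(\<lambda>k. a k i) \<longlonglongrightarrow> 0" if "i \<le> m" for i
  proof -
    have "(\<lambda>k. a k i * c i) \<longlonglongrightarrow> 0"
    proof (rule Suc.IH[where a = "\<lambda>k j. a k j * c j"])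
      fix s :: real assume s: "0 \<le> s" "s \<le> 1"
      have eq: "(\<Sum>j\<le>m. a k j * c j * s ^ j) =
          (\<Sum>j\<le>Suc m. a k j * s ^ j) - 2 ^ Suc m * (\<Sum>j\<le>Suc m. a k j * (s / 2) ^ j)" for k
      proof -
        have "(\<Sum>j\<le>m. a k j * c j * s ^ j) = (\<Sum>j\<le>Suc m. a k j * c j * s ^ j)"
          using c_top by simp
        also have "\<dots> = (\<Sum>j\<le>Suc m. a k j * s ^ j - 2 ^ Suc m * (a k j * (s / 2) ^ j))"
          by (intro sum.cong refl) (simp add: c_def power_divide algebra_simps)
        finally show ?thesis
          by (simp only: sum_subtractf sum_distrib_left)
      qed
      show "(\<lambda>k. \<Sum>j\<le>m. a k j * c j * s ^ j) \<longlonglongrightarrow> 0"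
        unfolding eq using tendsto_diff[OF Suc.prems(1)[of s]
          tendsto_mult_left[OF Suc.prems(1)[of "s / 2"], of "2 ^ Suc m"]] s by simp
    qed (use that in simp)
    then have "(\<lambda>k. a k i * c i / c i) \<longlonglongrightarrow> 0 / c i"
      by (intro tendsto_divide tendsto_const c_nz that)
    then show ?thesis using c_nz[OF that] by simp
  qed
  have "(\<lambda>k. (\<Sum>j\<le>Suc m. a k j * 1 ^ j) - (\<Sum>j\<le>m. a k j)) \<longlonglongrightarrow> 0 - (\<Sum>j\<le>m. 0)"
    by (intro tendsto_diff Suc.prems(1) tendsto_sum low) auto
  then have "(\<lambda>k. a k (Suc m)) \<longlonglongrightarrow> 0" by simp
  with low Suc.prems(2) show ?case by (cases "j = Suc m") auto
qed

lemma power_convex_combination: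
  fixes a b t :: real
  assumes "0 \<le> a" "0 \<le> b" "0 \<le> t" "t \<le> 1"
  shows "((1 - t) * a + t * b) ^ m \<le> (1 - t) * a ^ m + t * b ^ m"
proof -
  have "convex_on {0::real..} (\<lambda>x. x ^ m)"
    by (cases "even m") (auto intro: convex_power_odd convex_on_subset[OF convex_power_even])
  from convex_onD[OF this, of t a b] assms show ?thesis by simp
qed

text \<open>The difference quotient of the polynomial at 0 lies below the slope
  \<open>b - a 0\<close> of the chord, and it tends to the derivative \<open>a 1\<close> at 0, which
  vanishes.\<close>

lemma chord_end_ge_if_slope_zero:
  fixes a :: "nat \<Rightarrow> real"
  assumes "a 1 = 0" and "0 < m"
    and conv: "\<And>t. 0 \<le> t \<Longrightarrow> t \<le> 1 \<Longrightarrow> (\<Sum>j\<le>m. a j * t ^ j) \<le> (1 - t) * a 0 + t * b"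
  shows "a 0 \<le> b"
proof -
  \<comment> \<open>The difference quotient at 0, written as a polynomial so that it is continuous
    at 0 itself.\<close>
  define q where "q t = (\<Sum>j<m. a (Suc j) * t ^ j)" for t
  have split: "(\<Sum>j\<le>m. a j * t ^ j) = a 0 + t * q t" for t
  proof -
    have "(\<Sum>j\<le>m. a j * t ^ j) = a 0 + (\<Sum>j<m. a (Suc j) * t ^ Suc j)"
      by (subst sum.atMost_shift) simp
    then show ?thesis by (simp add: q_def sum_distrib_left algebra_simps)
  qed
  have le: "q t \<le> b - a 0" if "0 < t" "t \<le> 1" for t
  proof -
    have "t * q t \<le> t * (b - a 0)"
      using conv[of t] that split[of t] by (simp add: algebra_simps)
    then show ?thesis using that by simp
  qed
  have "q 0 = 0"
    using assms(1,2) by (simp add: q_def power_0_left lessThan_Suc_atMost if_distrib sum.delta cong: if_cong)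
  moreover have "continuous (at 0) q" unfolding q_def by (intro continuous_intros)
  ultimately have "(q \<longlongrightarrow> 0) (at_right 0)"
    by (simp add: continuous_at isCont_def filterlim_at_split)
  moreover have "eventually (\<lambda>t. q t \<le> b - a 0) (at_right 0)"
    unfolding eventually_at_right_field using le by (intro exI[of _ 1]) auto
  ultimately have "0 \<le> b - a 0"
    by (rule tendsto_upperbound) simp
  then show ?thesis by simp
qed

text \<open>
  Almost minimizers of the \<open>L\<^sup>2\<close> norm in a decreasing sequence of convex sets form a Cauchy sequence, by the
  parallelogram law. This replaces Mazur's lemma.
\<close>

lemma (in prob_space) midpoint_closed_AE_convergent:
  fixes K :: "nat \<Rightarrow> ('a \<Rightarrow> real) set"
  assumes ne: "\<And>k. K k \<noteq> {}" and dec: "decseq K"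
    and meas: "\<And>u. u \<in> K 0 \<Longrightarrow> u \<in> borel_measurable M"
    and bd: "\<And>u x. u \<in> K 0 \<Longrightarrow> x \<in> space M \<Longrightarrow> \<bar>u x\<bar> \<le> C"
    and mid: "\<And>k u v. u \<in> K k \<Longrightarrow> v \<in> K k \<Longrightarrow> (\<lambda>x. (u x + v x) / 2) \<in> K k"
  obtains u where "\<And>k. u k \<in> K k" "AE x in M. convergent (\<lambda>k. u k x)"
proof -
  have K0: "u \<in> K 0" if "u \<in> K k" for u k
    using that dec by (auto simp: decseq_def)
  have integ1: "integrable M u" if "u \<in> K 0" for u
    using bd[OF that] meas[OF that] by (intro integrable_const_bound[where B = C]) auto
  have integ2: "integrable M (\<lambda>x. u x * v x)" if "u \<in> K 0" "v \<in> K 0" for u v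
  proof -
    have [measurable]: "u \<in> borel_measurable M" "v \<in> borel_measurable M"
      using that meas by auto
    have "\<bar>u x * v x\<bar> \<le> C * C" if "x \<in> space M" for x
      using bd[OF \<open>u \<in> K 0\<close> that] bd[OF \<open>v \<in> K 0\<close> that] unfolding abs_mult
      by (intro mult_mono) auto
    then show "integrable M (\<lambda>x. u x * v x)"
      by (intro integrable_const_bound[where B = "C * C"]) auto
  qed
  \<comment> \<open>\<open>I\<close> is the squared \<open>L2\<close> norm and \<open>d k\<close>
    its infimum over \<open>K k\<close>. As the sets shrink, \<open>d\<close> increases; it is
    bounded by \<open>C * C\<close>, hence Cauchy.\<close>
  define I where "I u = (\<integral>x. u x * u x \<partial>M)" for u :: "'a \<Rightarrow> real"
  define d where "d k = Inf (I ` K k)" for k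
  have I_nonneg: "0 \<le> I u" for u unfolding I_def by (intro integral_nonneg_AE) auto
  have bddb: "bdd_below (I ` K k)" for k
    by (intro bdd_belowI[of _ 0]) (auto simp: I_nonneg)
  have d_le: "d k \<le> I u" if "u \<in> K k" for k u
    unfolding d_def using that bddb by (intro cInf_lower) auto
  have I_le: "I u \<le> C * C" if "u \<in> K 0" for u
  proof -
    have "I u \<le> (\<integral>x. C * C \<partial>M)"
      unfolding I_def
    proof (rule integral_mono)
      show "integrable M (\<lambda>x. u x * u x)" by (intro integ2 that)
      fix x assume "x \<in> space M"
      from bd[OF that this] show "u x * u x \<le> C * C"
        using mult_mono[of "\<bar>u x\<bar>" C "\<bar>u x\<bar>" C] by (simp add: flip: abs_mult)
    qed auto
    then show ?thesis by (simp add: prob_space)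
  qed
  have "\<exists>u. u \<in> K k \<and> I u < d k + inverse (real (Suc k))" for k
  proof -
    have "Inf (I ` K k) < d k + inverse (real (Suc k))" by (simp add: d_def)
    then show ?thesis using ne[of k] bddb[of k] by (subst (asm) cInf_less_iff) auto
  qed
  then obtain u where uK: "\<And>k. u k \<in> K k" and uI: "\<And>k. I (u k) < d k + inverse (real (Suc k))"
    by metis
  have uK': "u i \<in> K k" if "k \<le> i" for i k
    using uK[of i] dec that by (auto simp: decseq_def)
  have d_mono: "d i \<le> d j" if "i \<le> j" for i j
    unfolding d_def using ne bddb dec that
    by (intro cInf_superset_mono image_mono) (auto simp: decseq_def)
  have "bdd_above (range d)"
  proof (intro bdd_aboveI[of _ "C * C"], clarsimp)
    fix k show "d k \<le> C * C" using d_le[OF uK] I_le[OF K0[OF uK]] order_trans by blast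
  qed
  then have "d \<longlonglongrightarrow> (SUP k. d k)"
    by (intro LIMSEQ_incseq_SUP) (auto simp: incseq_def d_mono)
  then have "Cauchy d" using convergent_Cauchy convergentI by blast
  have parallelogram: "(\<integral>x. (u i x - u j x)^2 \<partial>M) = 2 * I (u i) + 2 * I (u j) - 4 * I (\<lambda>x. (u i x + u j x) / 2)"
    for i j
  proof -
    have *: "integrable M (\<lambda>x. u i x * u j x)" for i j by (intro integ2 K0[OF uK])
    show ?thesis unfolding I_def power2_eq_square
      using *[of i i] *[of i j] *[of j j] by (simp add: field_simps)
  qed
  have sq_small: "\<exists>N. \<forall>i\<ge>N. \<forall>j\<ge>N. (\<integral>x. (u i x - u j x)^2 \<partial>M) < e" if "e > 0" for e
  proof -
    obtain N1 where N1: "\<And>i j. i \<ge> N1 \<Longrightarrow> j \<ge> N1 \<Longrightarrow> dist (d i) (d j) < e / 8"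
      using \<open>Cauchy d\<close> \<open>e > 0\<close> unfolding Cauchy_def by (metis divide_pos_pos zero_less_numeral)
    obtain N2 where N2: "inverse (real (Suc N2)) < e / 8"
      using reals_Archimedean[of "e / 8"] \<open>e > 0\<close> by auto
    have "(\<integral>x. (u i x - u j x)^2 \<partial>M) < e" if ij: "i \<ge> max N1 N2" "j \<ge> max N1 N2" for i j
    proof -
      define k where "k = max N1 N2"
      \<comment> \<open>The midpoint has \<open>I\<close> at least \<open>d k\<close>, while
        \<open>I (u i)\<close> and \<open>I (u j)\<close> are both below \<open>d k + e / 4\<close>.
        The parallelogram law turns this into the bound \<open>e\<close>.\<close>
      have "(\<lambda>x. (u i x + u j x) / 2) \<in> K k"
        using ij by (intro mid uK') (auto simp: k_def)
      note d_le[OF this]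
      moreover have "inverse (real (Suc i)) \<le> inverse (real (Suc N2))"
        "inverse (real (Suc j)) \<le> inverse (real (Suc N2))" using ij by auto
      moreover have "dist (d i) (d k) < e / 8" "dist (d j) (d k) < e / 8"
        using N1[of i k] N1[of j k] ij by (simp_all add: k_def)
      ultimately show ?thesis
        using uI[of i] uI[of j] N2 unfolding parallelogram dist_real_def by linarith
    qed
    then show ?thesis by blast
  qed
  have L1_small: "\<exists>N. \<forall>i\<ge>N. \<forall>j\<ge>N. (\<integral>x. norm (u i x - u j x) \<partial>M) < e" if "e > 0" for e
  proof -
    obtain N where N: "\<And>i j. i \<ge> N \<Longrightarrow> j \<ge> N \<Longrightarrow> (\<integral>x. (u i x - u j x)^2 \<partial>M) < e * e / 2"
      using sq_small[of "e * e / 2"] \<open>e > 0\<close> by auto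
    have "(\<integral>x. norm (u i x - u j x) \<partial>M) < e" if ij: "i \<ge> N" "j \<ge> N" for i j
    proof -
      have i1: "integrable M (\<lambda>x. (u i x - u j x)^2)"
        unfolding power2_eq_square left_diff_distrib right_diff_distrib
        by (intro Bochner_Integration.integrable_diff integ2 K0[OF uK])
      have i2: "integrable M (\<lambda>x. u i x - u j x)"
        by (intro Bochner_Integration.integrable_diff integ1 K0[OF uK])
      \<comment> \<open>The inequality \<open>\<bar>v\<bar> \<le> e / 2 + v^2 / (2 * e)\<close>
        transfers smallness from \<open>L2\<close> to \<open>L1\<close>, where Cauchy sequences have
        almost everywhere Cauchy subsequences.\<close>
      have "(\<integral>x. norm (u i x - u j x) \<partial>M) \<le> (\<integral>x. e / 2 + (u i x - u j x)^2 / (2 * e) \<partial>M)"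
      proof (intro integral_mono)
        fix x
        have "0 \<le> (\<bar>u i x - u j x\<bar> - e)^2" by simp
        then have "2 * e * \<bar>u i x - u j x\<bar> \<le> e^2 + (u i x - u j x)^2"
          by (simp add: power2_eq_square algebra_simps flip: abs_mult)
        then show "norm (u i x - u j x) \<le> e / 2 + (u i x - u j x)^2 / (2 * e)"
          using \<open>e > 0\<close> by (simp add: field_simps power2_eq_square)
      qed (use i1 i2 in auto)
      also have "\<dots> = e / 2 + (\<integral>x. (u i x - u j x)^2 \<partial>M) / (2 * e)"
        using i1 by (simp add: prob_space)
      also have "\<dots> < e / 2 + (e * e / 2) / (2 * e)"
        using N[OF ij] \<open>e > 0\<close> by (intro add_strict_left_mono divide_strict_right_mono) auto
      also have "\<dots> \<le> e" using \<open>e > 0\<close> by (simp add: field_simps)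
      finally show ?thesis .
    qed
    then show ?thesis by blast
  qed
  have "integrable M (u k)" for k using integ1 K0[OF uK] by blast
  from cauchy_L1_AE_cauchy_subseq[OF this L1_small]
  obtain r where r: "strict_mono r" "AE x in M. Cauchy (\<lambda>k. u (r k) x)" by blast
  show thesis
  proof (rule that[of "\<lambda>k. u (r k)"])
    \<comment> \<open>The subsequence stays admissible because \<open>r k \<ge> k\<close> and
      \<open>K\<close> decreases.\<close>
    show "u (r k) \<in> K k" for k
      using seq_suble[OF r(1), of k] by (rule uK')
    show "AE x in M. convergent (\<lambda>k. u (r k) x)"
      using r(2) by (simp add: Cauchy_convergent_iff)
  qed
qed

text \<open>The preimage of a rectangle is a cylinder over two coordinates, whose measure factors,
  and rectangles determine a product measure. Applied to the ends of an edge, this moves null sets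
  and integrals between the vertex space and the square.\<close>

lemma (in prob_space) distr_PiM_pair:
  assumes "finite I" "a \<in> I" "b \<in> I" "a \<noteq> b"
  shows "distr (PiM I (\<lambda>_. M)) (M \<Otimes>\<^sub>M M) (\<lambda>x. (x a, x b)) = M \<Otimes>\<^sub>M M"
proof (rule pair_measure_eqI[symmetric])
  interpret product_prob_space "\<lambda>_. M" by unfold_locales
  have [measurable]: "(\<lambda>x. (x a, x b)) \<in> measurable (PiM I (\<lambda>_. M)) (M \<Otimes>\<^sub>M M)"
    using assms by measurable
  fix A B assume [measurable]: "A \<in> sets M" "B \<in> sets M"
  have "emeasure (PiM I (\<lambda>_. M)) {x\<in>space (PiM I (\<lambda>_. M)). \<forall>i\<in>{a,b}. x i \<in> (if i = a then A else B)}
      = (\<Prod>i\<in>{a,b}. emeasure M (if i = a then A else B))"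
    using assms by (intro emeasure_PiM_Collect) auto
  also have "\<dots> = emeasure M A * emeasure M B" using assms by simp
  also have "{x\<in>space (PiM I (\<lambda>_. M)). \<forall>i\<in>{a,b}. x i \<in> (if i = a then A else B)} =
      (\<lambda>x. (x a, x b)) -` (A \<times> B) \<inter> space (PiM I (\<lambda>_. M))" using assms by auto
  finally show "emeasure M A * emeasure M B =
      emeasure (distr (PiM I (\<lambda>_. M)) (M \<Otimes>\<^sub>M M) (\<lambda>x. (x a, x b))) (A \<times> B)"
    by (subst emeasure_distr) auto
qed (auto intro: sigma_finite_measure_axioms)

text \<open>Rectangles form an intersection-stable generator, so equality of the integrals spreads
  to all measurable sets by Dynkin induction. Weak* limits are thereby unique up to null
  sets.\<close>

lemma AE_eq_if_set_integral_Times_eq: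
  fixes f g :: "'a \<times> 'b \<Rightarrow> real"
  assumes int: "integrable (M \<Otimes>\<^sub>M N) f" "integrable (M \<Otimes>\<^sub>M N) g"
    and rect: "\<And>S T. S \<in> sets M \<Longrightarrow> T \<in> sets N \<Longrightarrow>
      set_lebesgue_integral (M \<Otimes>\<^sub>M N) (S \<times> T) f = set_lebesgue_integral (M \<Otimes>\<^sub>M N) (S \<times> T) g"
  shows "AE z in M \<Otimes>\<^sub>M N. f z = g z"
proof (rule density_unique_real[OF int])
  let ?G = "{a \<times> b |a b. a \<in> sets M \<and> b \<in> sets N}"
  have si: "set_integrable (M \<Otimes>\<^sub>M N) A f" "set_integrable (M \<Otimes>\<^sub>M N) A g" if "A \<in> sets (M \<Otimes>\<^sub>M N)" for A
    using int that unfolding set_integrable_def by (blast intro: integrable_mult_indicator)+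
  fix A assume "A \<in> sets (M \<Otimes>\<^sub>M N)"
  then have "A \<in> sigma_sets (space M \<times> space N) ?G" by (simp add: sets_pair_measure)
  from Int_stable_pair_measure_generator pair_measure_closed this
  show "(\<integral>x\<in>A. f x \<partial>(M \<Otimes>\<^sub>M N)) = (\<integral>x\<in>A. g x \<partial>(M \<Otimes>\<^sub>M N))"
  proof (induction A rule: sigma_sets_induct_disjoint)
    case (basic A)
    then show ?case using rect by auto
  next
    case empty
    then show ?case by (simp add: set_lebesgue_integral_def)
  next
    case (compl A)
    then have A: "A \<in> sets (M \<Otimes>\<^sub>M N)" by (simp add: sets_pair_measure)
    let ?X = "space M \<times> space N"
    have X: "?X - A \<in> sets (M \<Otimes>\<^sub>M N)" using A by (metis sets.compl_sets space_pair_measure)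
    have sub: "A \<subseteq> ?X" using sets.sets_into_space[OF A] by (simp add: space_pair_measure)
    have "(\<integral>x\<in>?X. h x \<partial>(M \<Otimes>\<^sub>M N)) = (\<integral>x\<in>?X - A. h x \<partial>(M \<Otimes>\<^sub>M N)) + (\<integral>x\<in>A. h x \<partial>(M \<Otimes>\<^sub>M N))"
      if "\<And>A. A \<in> sets (M \<Otimes>\<^sub>M N) \<Longrightarrow> set_integrable (M \<Otimes>\<^sub>M N) A h" for h :: "_ \<Rightarrow> real"
      using set_integral_Un[of "?X - A" A, OF _ that[OF X] that[OF A]] sub by (auto simp: Un_absorb2)
    from this[of f, OF si(1)] this[of g, OF si(2)] compl.IH rect[of "space M" "space N"]
    show ?case by simp
  next
    case (union A)
    then have A: "A i \<in> sets (M \<Otimes>\<^sub>M N)" for i by (auto simp: sets_pair_measure)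
    then have "(\<Union>i. A i) \<in> sets (M \<Otimes>\<^sub>M N)" by auto
    note si = si[OF this]
    show ?case
      using A union.hyps(1) union.IH
      by (subst (1 2) lebesgue_integral_countable_add)
         (auto intro!: si suminf_cong simp: disjoint_family_on_def)
  qed
qed

section \<open>Kernels and measure preserving bijections\<close>

lemma kernel_measurable: "kernel M W \<Longrightarrow> W \<in> borel_measurable (M \<Otimes>\<^sub>M M)"
  by (simp add: kernel_def)

lemma kernel_bounded:
  assumes "kernel M W"
  obtains C where "\<And>z. z \<in> space (M \<Otimes>\<^sub>M M) \<Longrightarrow> \<bar>W z\<bar> \<le> C"
proof -
  obtain C where "\<forall>x\<in>space M. \<forall>y\<in>space M. \<bar>W (x, y)\<bar> \<le> C"
    using assms by (auto simp: kernel_def)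
  then show thesis by (intro that[of C]) (auto simp: space_pair_measure)
qed

lemma kernel_affine:
  assumes "kernel M U" "kernel M W"
  shows "kernel M (\<lambda>z. r * U z + s * W z)"
proof -
  obtain C where C: "\<And>z. z \<in> space (M \<Otimes>\<^sub>M M) \<Longrightarrow> \<bar>U z\<bar> \<le> C"
    using kernel_bounded[OF assms(1)] by blast
  obtain D where D: "\<And>z. z \<in> space (M \<Otimes>\<^sub>M M) \<Longrightarrow> \<bar>W z\<bar> \<le> D"
    using kernel_bounded[OF assms(2)] by blast
  have "\<bar>r * U z + s * W z\<bar> \<le> \<bar>r\<bar> * C + \<bar>s\<bar> * D" if "z \<in> space (M \<Otimes>\<^sub>M M)" for z
  proof -
    have "\<bar>r * U z + s * W z\<bar> \<le> \<bar>r\<bar> * \<bar>U z\<bar> + \<bar>s\<bar> * \<bar>W z\<bar>"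
      by (metis abs_mult abs_triangle_ineq)
    also have "\<dots> \<le> \<bar>r\<bar> * C + \<bar>s\<bar> * D"
      by (intro add_mono mult_left_mono C D that) auto
    finally show ?thesis .
  qed
  then show ?thesis
    using assms unfolding kernel_def by (auto simp: space_pair_measure)
qed

lemma kernel_add: "kernel M U \<Longrightarrow> kernel M W \<Longrightarrow> kernel M (\<lambda>z. U z + W z)"
  using kernel_affine[of M U W 1 1] by simp

lemma kernel_diff: "kernel M U \<Longrightarrow> kernel M W \<Longrightarrow> kernel M (\<lambda>z. U z - W z)"
  using kernel_affine[of M U W 1 "-1"] by simp

lemma kernel_scale: "kernel M W \<Longrightarrow> kernel M (\<lambda>z. s * W z)"
  using kernel_affine[of M W W 0 s] by simp

lemma kernel_const: "kernel M (\<lambda>_. c)"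
  by (auto simp: kernel_def)

lemma graphon_kernel: "graphon M W \<Longrightarrow> kernel M W"
  by (simp add: graphon_def)

lemma graphon_bounds:
  assumes "graphon M W" "z \<in> space (M \<Otimes>\<^sub>M M)"
  shows "0 \<le> W z" "W z \<le> 1"
  using assms by (auto simp: graphon_def space_pair_measure)

lemma graphonI:
  "kernel M W \<Longrightarrow> (\<And>z. z \<in> space (M \<Otimes>\<^sub>M M) \<Longrightarrow> 0 \<le> W z \<and> W z \<le> 1) \<Longrightarrow> graphon M W"
  by (auto simp: graphon_def space_pair_measure)

lemma graphon_segment:
  assumes "graphon M U" "graphon M (\<lambda>z. U z + V z)" "0 \<le> t" "t \<le> 1" "kernel M V"
  shows "graphon M (\<lambda>z. U z + t * V z)"
proof (rule graphonI)
  show "kernel M (\<lambda>z. U z + t * V z)"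
    using kernel_affine[OF graphon_kernel[OF assms(1)] assms(5), of 1 t] by simp
  fix z assume z: "z \<in> space (M \<Otimes>\<^sub>M M)"
  have eq: "U z + t * V z = (1 - t) * U z + t * (U z + V z)" by (simp add: algebra_simps)
  have "(1 - t) * U z + t * (U z + V z) \<le> 1"
    using assms by (intro convex_bound_le graphon_bounds[OF assms(1) z] graphon_bounds[OF assms(2) z]) auto
  moreover have "0 \<le> (1 - t) * U z + t * (U z + V z)"
    using assms graphon_bounds[OF assms(1) z] graphon_bounds[OF assms(2) z] by simp
  ultimately show "0 \<le> U z + t * V z \<and> U z + t * V z \<le> 1" unfolding eq by simp
qed

section \<open>Measure preserving bijections and their action on kernels\<close>

lemma mp_bij_space: "mp_bij M \<phi> \<Longrightarrow> x \<in> space M \<Longrightarrow> \<phi> x \<in> space M"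
  by (auto simp: mp_bij_def measurable_space)

lemma kernel_pullback:
  assumes "mp_bij M \<phi>" "kernel M W"
  shows "kernel M (pullback \<phi> W)"
proof -
  have [measurable]: "\<phi> \<in> measurable M M" "W \<in> borel_measurable (M \<Otimes>\<^sub>M M)"
    using assms by (auto simp: mp_bij_def kernel_def)
  have "pullback \<phi> W \<in> borel_measurable (M \<Otimes>\<^sub>M M)"
    unfolding pullback_def by measurable
  moreover obtain C where "\<forall>x\<in>space M. \<forall>y\<in>space M. \<bar>W (x, y)\<bar> \<le> C"
    using assms(2) by (auto simp: kernel_def)
  then have "\<forall>x\<in>space M. \<forall>y\<in>space M. \<bar>pullback \<phi> W (x, y)\<bar> \<le> C"
    using mp_bij_space[OF assms(1)] by (simp add: pullback_def)
  moreover have "\<forall>x\<in>space M. \<forall>y\<in>space M. pullback \<phi> W (x, y) = pullback \<phi> W (y, x)"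
    using assms(2) mp_bij_space[OF assms(1)] by (simp add: kernel_def pullback_def)
  ultimately show ?thesis unfolding kernel_def by blast
qed

lemma graphon_pullback:
  assumes "mp_bij M \<phi>" "graphon M W"
  shows "graphon M (pullback \<phi> W)"
  using assms kernel_pullback[OF assms(1) graphon_kernel[OF assms(2)]] mp_bij_space[OF assms(1)]
  by (auto simp: graphon_def pullback_def)

lemma mp_bij_id: "mp_bij M (\<lambda>x. x)"
proof -
  have "the_inv_into (space M) (\<lambda>x. x) x = x" if "x \<in> space M" for x
    using that by (intro the_inv_into_f_eq) auto
  then have "the_inv_into (space M) (\<lambda>x. x) \<in> measurable M M"
    by (subst measurable_cong[where g = "\<lambda>x. x"]) auto
  then show ?thesis by (auto simp: mp_bij_def bij_betw_def distr_id)
qed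

lemma mp_bij_inverse:
  assumes "mp_bij M \<phi>"
  obtains \<psi> where "mp_bij M \<psi>" "\<And>x. x \<in> space M \<Longrightarrow> \<phi> (\<psi> x) = x"
proof
  let ?\<psi> = "the_inv_into (space M) \<phi>"
  have bij: "bij_betw \<phi> (space M) (space M)" and
    meas [measurable]: "\<phi> \<in> measurable M M" "?\<psi> \<in> measurable M M" and d: "distr M M \<phi> = M"
    using assms by (auto simp: mp_bij_def)
  have bij': "bij_betw ?\<psi> (space M) (space M)" by (rule bij_betw_the_inv_into[OF bij])
  show inv: "\<phi> (?\<psi> x) = x" if "x \<in> space M" for x
    using bij that by (rule f_the_inv_into_f_bij_betw)
  have inv': "?\<psi> (\<phi> x) = x" if "x \<in> space M" for x
    using bij that by (auto intro: the_inv_into_f_f simp: bij_betw_def)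
  have "the_inv_into (space M) ?\<psi> x = \<phi> x" if "x \<in> space M" for x
    using bij' inv'[OF that] mp_bij_space[OF assms that]
    by (intro the_inv_into_f_eq[of ?\<psi>]) (auto simp: bij_betw_def)
  then have "the_inv_into (space M) ?\<psi> \<in> measurable M M"
    by (subst measurable_cong[where g = \<phi>]) auto
  moreover have "distr M M ?\<psi> = M"
  proof -
    have "distr M M ?\<psi> = distr (distr M M \<phi>) M ?\<psi>" by (simp add: d)
    also have "\<dots> = distr M M (?\<psi> \<circ> \<phi>)" by (simp add: distr_distr)
    also have "\<dots> = distr M M (\<lambda>x. x)" by (intro distr_cong) (auto simp: inv')
    finally show ?thesis by (simp add: distr_id)
  qed
  ultimately show "mp_bij M ?\<psi>" using bij' by (simp add: mp_bij_def)
qed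

lemma mp_bij_comp:
  assumes "mp_bij M \<phi>" "mp_bij M \<psi>"
  shows "mp_bij M (\<phi> \<circ> \<psi>)"
proof -
  let ?i = "the_inv_into (space M)"
  have [measurable]: "\<phi> \<in> measurable M M" "\<psi> \<in> measurable M M" "?i \<phi> \<in> measurable M M" "?i \<psi> \<in> measurable M M"
    and d: "distr M M \<phi> = M" "distr M M \<psi> = M"
    and b: "bij_betw \<phi> (space M) (space M)" "bij_betw \<psi> (space M) (space M)"
    using assms by (auto simp: mp_bij_def)
  have bb: "bij_betw (\<phi> \<circ> \<psi>) (space M) (space M)"
    using b by (rule bij_betw_trans[rotated])
  have "?i (\<phi> \<circ> \<psi>) x = (?i \<psi> \<circ> ?i \<phi>) x" if "x \<in> space M" for x
  proof -
    have 1: "?i \<phi> x \<in> space M" using b(1) that by (meson bij_betwE bij_betw_the_inv_into)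
    then have 2: "?i \<psi> (?i \<phi> x) \<in> space M" using b(2) by (meson bij_betwE bij_betw_the_inv_into)
    show ?thesis
      using bb 2 f_the_inv_into_f_bij_betw[OF b(2) 1] f_the_inv_into_f_bij_betw[OF b(1) that]
      by (intro the_inv_into_f_eq[of "\<phi> \<circ> \<psi>"]) (auto simp: bij_betw_def)
  qed
  then have "?i (\<phi> \<circ> \<psi>) \<in> measurable M M"
    by (subst measurable_cong[where g = "?i \<psi> \<circ> ?i \<phi>"]) auto
  moreover have "distr M M (\<phi> \<circ> \<psi>) = M"
    using d distr_distr[of \<phi> M M \<psi> M] by simp
  ultimately show ?thesis using bb by (simp add: mp_bij_def)
qed

section \<open>Integrals and almost everywhere limits of kernels\<close>

context prob_space
begin

lemma prob_space_square: "prob_space (M \<Otimes>\<^sub>M M)"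
proof -
  interpret pair_prob_space M M by unfold_locales
  show ?thesis by unfold_locales
qed

lemma kernel_integrable:
  assumes "kernel M W"
  shows "integrable (M \<Otimes>\<^sub>M M) W"
proof -
  interpret Q: prob_space "M \<Otimes>\<^sub>M M" by (rule prob_space_square)
  obtain C where "\<And>z. z \<in> space (M \<Otimes>\<^sub>M M) \<Longrightarrow> \<bar>W z\<bar> \<le> C" using kernel_bounded[OF assms] by blast
  then show ?thesis
    using kernel_measurable[OF assms] by (intro Q.integrable_const_bound[where B = C]) auto
qed

lemma kernel_set_integrable:
  assumes "kernel M W" "A \<in> sets (M \<Otimes>\<^sub>M M)"
  shows "set_integrable (M \<Otimes>\<^sub>M M) A W"
  unfolding set_integrable_def
  by (rule integrable_mult_indicator[OF assms(2) kernel_integrable[OF assms(1)]])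

lemma set_integral_AE_tendsto:
  assumes "\<And>k. kernel M (u k)" "kernel M V" "A \<in> sets (M \<Otimes>\<^sub>M M)"
    and "\<And>k z. z \<in> space (M \<Otimes>\<^sub>M M) \<Longrightarrow> \<bar>u k z\<bar> \<le> C"
    and "AE z in M \<Otimes>\<^sub>M M. (\<lambda>k. u k z) \<longlonglongrightarrow> V z"
  shows "(\<lambda>k. set_lebesgue_integral (M \<Otimes>\<^sub>M M) A (u k)) \<longlonglongrightarrow> set_lebesgue_integral (M \<Otimes>\<^sub>M M) A V"
proof -
  interpret Q: prob_space "M \<Otimes>\<^sub>M M" by (rule prob_space_square)
  note [measurable] = assms(3) kernel_measurable[OF assms(1)] kernel_measurable[OF assms(2)]
  show ?thesis
    unfolding set_lebesgue_integral_def
  proof (rule integral_dominated_convergence[where w = "\<lambda>_. C"])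
    show "AE z in M \<Otimes>\<^sub>M M. (\<lambda>k. indicator A z *\<^sub>R u k z) \<longlonglongrightarrow> indicator A z *\<^sub>R V z"
      using assms(5) by eventually_elim (auto intro: tendsto_intros)
    show "AE z in M \<Otimes>\<^sub>M M. norm (indicator A z *\<^sub>R u k z) \<le> C" for k
      using assms(4) by (intro AE_I2) (auto simp: indicator_def intro: order_trans[OF abs_ge_zero])
  qed auto
qed

text \<open>Kernels are functions rather than classes, so the almost everywhere limit has to be
  turned into a function that is measurable, bounded and symmetric at every point.\<close>

lemma kernel_midpoint_closed_limit:
  assumes ne: "\<And>k. K k \<noteq> {}" and dec: "decseq K"
    and ker: "\<And>u. u \<in> K 0 \<Longrightarrow> kernel M u"
    and bd: "\<And>u z. u \<in> K 0 \<Longrightarrow> z \<in> space (M \<Otimes>\<^sub>M M) \<Longrightarrow> \<bar>u z\<bar> \<le> C"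
    and mid: "\<And>k u v. u \<in> K k \<Longrightarrow> v \<in> K k \<Longrightarrow> (\<lambda>z. (u z + v z) / 2) \<in> K k"
  obtains u V where "\<And>k. u k \<in> K k" "kernel M V" "AE z in M \<Otimes>\<^sub>M M. (\<lambda>k. u k z) \<longlonglongrightarrow> V z"
proof -
  interpret Q: prob_space "M \<Otimes>\<^sub>M M" by (rule prob_space_square)
  obtain u where u: "\<And>k. u k \<in> K k" and conv: "AE z in M \<Otimes>\<^sub>M M. convergent (\<lambda>k. u k z)"
    by (rule Q.midpoint_closed_AE_convergent[of K C])
       (use assms kernel_measurable in \<open>blast+\<close>)
  have u0: "u k \<in> K 0" for k using u[of k] dec by (auto simp: decseq_def)
  note [measurable] = kernel_measurable[OF ker[OF u0]]
  \<comment> \<open>Clipping tames the junk value of \<open>lim\<close> where the sequence diverges.\<close>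
  define V where "V z = max (- C) (min C (lim (\<lambda>k. u k z)))" for z
  \<comment> \<open>Clipping lands in \<open>[-C, C]\<close> only for nonnegative \<open>C\<close>;
    a point of the space provides this.\<close>
  have "C \<ge> 0"
    using bd[OF u0[of 0]] Q.not_empty by (meson abs_ge_zero all_not_in_conv order_trans)
  have "kernel M V"
    unfolding kernel_def
  proof (intro conjI exI ballI)
    have "(\<lambda>z. lim (\<lambda>k. u k z)) \<in> borel_measurable (M \<Otimes>\<^sub>M M)" by measurable
    then show "V \<in> borel_measurable (M \<Otimes>\<^sub>M M)" unfolding V_def by measurable
    show "\<bar>V (x, y)\<bar> \<le> C" for x y using \<open>C \<ge> 0\<close> by (auto simp: V_def)
    \<comment> \<open>The sequences at \<open>(x, y)\<close> and \<open>(y, x)\<close> coincide, so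
      symmetry persists even where they diverge.\<close>
    fix x y assume "x \<in> space M" "y \<in> space M"
    then have "u k (x, y) = u k (y, x)" for k using ker[OF u0[of k]] by (auto simp: kernel_def)
    then show "V (x, y) = V (y, x)" by (simp add: V_def)
  qed
  moreover have "AE z in M \<Otimes>\<^sub>M M. (\<lambda>k. u k z) \<longlonglongrightarrow> V z"
    using conv AE_space
  proof eventually_elim
    case (elim z)
    then have L: "(\<lambda>k. u k z) \<longlonglongrightarrow> lim (\<lambda>k. u k z)" by (simp add: convergent_LIMSEQ_iff)
    have "\<bar>u k z\<bar> \<le> C" for k using bd[OF u0] elim(2) by auto
    then have "lim (\<lambda>k. u k z) \<le> C" "- C \<le> lim (\<lambda>k. u k z)"
      by (auto intro!: LIMSEQ_le_const2[OF L] LIMSEQ_le_const[OF L] simp: abs_le_iff minus_le_iff)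
    with L show ?case by (simp add: V_def)
  qed
  ultimately show thesis using that u by blast
qed

end

text \<open>Bundling the ends of an edge gives one map into the square per edge, measure preserving
  by \<open>distr_edge_point\<close>.\<close>

definition edge_point :: "(nat \<Rightarrow> 'a) \<Rightarrow> nat set \<Rightarrow> 'a \<times> 'a" where
  "edge_point x e = (x (Min e), x (Max e))"

lemma hom_density_edge_point:
  "hom_density M n E W = (\<integral>x. (\<Prod>e\<in>E. W (edge_point x e)) \<partial>(PiM {..<n} (\<lambda>_. M)))"
  by (simp add: hom_density_def edge_point_def)

section \<open>The density and the norm of a norming graph\<close>

locale norming_graph = prob_space M for M :: "'a measure" +
  fixes n :: nat and E :: "nat set set"
  assumes simple: "simple_graph n E" and norming: "norming M n E"
begin

abbreviation "vertex_space \<equiv> PiM {..<n} (\<lambda>_. M)"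
abbreviation "dens \<equiv> hom_density M n E"
abbreviation "gnorm \<equiv> graph_norm M n E"

lemma finite_edges: "finite E"
  by (rule finite_subset[of _ "Pow {..<n}"]) (use simple in \<open>auto simp: simple_graph_def\<close>)

lemma edge_ends:
  assumes "e \<in> E"
  shows "Min e < n" "Max e < n" "Min e \<noteq> Max e"
proof -
  obtain a b where e: "e = {a, b}" "a \<noteq> b" "a < n" "b < n"
    using assms simple by (auto simp: simple_graph_def card_2_iff)
  show "Min e < n" "Max e < n" "Min e \<noteq> Max e"
    using e by (auto simp: min_def max_def)
qed

sublocale vertices: prob_space vertex_space
  by (intro prob_space_PiM prob_space_axioms)

lemma edge_point_measurable:
  "e \<in> E \<Longrightarrow> (\<lambda>x. edge_point x e) \<in> measurable vertex_space (M \<Otimes>\<^sub>M M)"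
  using edge_ends[of e] unfolding edge_point_def
  by (intro measurable_Pair measurable_component_singleton) auto

lemma edge_point_space: "e \<in> E \<Longrightarrow> x \<in> space vertex_space \<Longrightarrow> edge_point x e \<in> space (M \<Otimes>\<^sub>M M)"
  using edge_point_measurable by (rule measurable_space)

lemma distr_edge_point: "e \<in> E \<Longrightarrow> distr vertex_space (M \<Otimes>\<^sub>M M) (\<lambda>x. edge_point x e) = M \<Otimes>\<^sub>M M"
  unfolding edge_point_def using edge_ends[of e] by (intro distr_PiM_pair) auto

text \<open>Each edge maps the vertex space to the square measure preservingly, so null sets have
  null preimages, and there are finitely many edges.\<close>

lemma AE_edge_point:
  assumes "AE z in M \<Otimes>\<^sub>M M. Q z"
  shows "AE x in vertex_space. \<forall>e\<in>E. Q (edge_point x e)"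
proof (intro AE_finite_allI finite_edges)
  fix e assume e: "e \<in> E"
  have "AE z in distr vertex_space (M \<Otimes>\<^sub>M M) (\<lambda>x. edge_point x e). Q z"
    by (simp only: distr_edge_point[OF e] assms)
  then show "AE x in vertex_space. Q (edge_point x e)"
    by (rule AE_distrD[OF edge_point_measurable[OF e]])
qed

lemma kernel_edge_measurable:
  "e \<in> E \<Longrightarrow> kernel M W \<Longrightarrow> (\<lambda>x. W (edge_point x e)) \<in> borel_measurable vertex_space"
  by (rule measurable_compose[OF edge_point_measurable kernel_measurable])

lemma integrable_edge_prod:
  assumes "S \<subseteq> E" "\<And>e. e \<in> S \<Longrightarrow> kernel M (w e)"
  shows "integrable vertex_space (\<lambda>x. \<Prod>e\<in>S. w e (edge_point x e))"
proof -
  have "\<forall>e\<in>S. \<exists>C. \<forall>z\<in>space (M \<Otimes>\<^sub>M M). \<bar>w e z\<bar> \<le> C"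
    using kernel_bounded[OF assms(2)] by metis
  then obtain C where C: "\<And>e z. e \<in> S \<Longrightarrow> z \<in> space (M \<Otimes>\<^sub>M M) \<Longrightarrow> \<bar>w e z\<bar> \<le> C e" by metis
  show ?thesis
  proof (rule vertices.integrable_const_bound[where B = "\<Prod>e\<in>S. C e"])
    show "AE x in vertex_space. norm (\<Prod>e\<in>S. w e (edge_point x e)) \<le> (\<Prod>e\<in>S. C e)"
      unfolding real_norm_def abs_prod
      using assms(1) by (intro AE_I2 prod_mono conjI abs_ge_zero C edge_point_space) auto
    show "(\<lambda>x. \<Prod>e\<in>S. w e (edge_point x e)) \<in> borel_measurable vertex_space"
      using assms by (intro borel_measurable_prod kernel_edge_measurable) auto
  qed
qed

definition mixed :: "('a \<times> 'a \<Rightarrow> real) \<Rightarrow> ('a \<times> 'a \<Rightarrow> real) \<Rightarrow> nat set set \<Rightarrow> real" where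
  "mixed U V S = (\<integral>x. (\<Prod>e\<in>S. V (edge_point x e)) * (\<Prod>e\<in>E - S. U (edge_point x e)) \<partial>vertex_space)"

text \<open>The coefficient of \<open>s ^ j\<close> in the density of \<open>U + s V\<close>; see
  \<open>dens_line\<close>.\<close>

definition coefficient :: "('a \<times> 'a \<Rightarrow> real) \<Rightarrow> ('a \<times> 'a \<Rightarrow> real) \<Rightarrow> nat \<Rightarrow> real" where
  "coefficient U V j = (\<Sum>S | S \<subseteq> E \<and> card S = j. mixed U V S)"

lemma integrable_mixed:
  assumes "kernel M U" "kernel M V" "S \<subseteq> E"
  shows "integrable vertex_space (\<lambda>x. (\<Prod>e\<in>S. V (edge_point x e)) * (\<Prod>e\<in>E - S. U (edge_point x e)))"
proof -
  have "(\<Prod>e\<in>S. V (edge_point x e)) * (\<Prod>e\<in>E - S. U (edge_point x e)) =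
      (\<Prod>e\<in>E. (if e \<in> S then V else U) (edge_point x e))" for x
    by (subst prod.subset_diff[OF assms(3) finite_edges]) (simp add: mult.commute)
  then show ?thesis using assms by (simp only:) (intro integrable_edge_prod, auto)
qed

text \<open>When the product over the edges is multiplied out, each edge selects \<open>V\<close> or
  \<open>U\<close>; the sets of edges selecting \<open>V\<close> are grouped by size.\<close>

lemma dens_line:
  assumes "kernel M U" "kernel M V"
  shows "dens (\<lambda>z. U z + s * V z) = (\<Sum>j\<le>card E. coefficient U V j * s ^ j)"
proof -
  have "dens (\<lambda>z. U z + s * V z) = (\<integral>x. (\<Prod>e\<in>E. s * V (edge_point x e) + U (edge_point x e)) \<partial>vertex_space)"
    by (simp add: hom_density_edge_point add.commute)
  also have "\<dots> = (\<integral>x. (\<Sum>S\<in>Pow E. s ^ card S *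
      ((\<Prod>e\<in>S. V (edge_point x e)) * (\<Prod>e\<in>E - S. U (edge_point x e)))) \<partial>vertex_space)"
    by (simp add: prod_add[OF finite_edges] prod.distrib mult.assoc)
  also have "\<dots> = (\<Sum>S\<in>Pow E. s ^ card S * mixed U V S)"
    unfolding mixed_def using integrable_mixed[OF assms] by (subst Bochner_Integration.integral_sum) auto
  also have "\<dots> = (\<Sum>j\<le>card E. \<Sum>S | S \<in> Pow E \<and> card S = j. s ^ card S * mixed U V S)"
    using finite_edges by (intro sum.group[symmetric]) (auto intro: card_mono)
  also have "\<dots> = (\<Sum>j\<le>card E. coefficient U V j * s ^ j)"
    by (intro sum.cong refl) (simp add: coefficient_def sum_distrib_left mult.commute)
  finally show ?thesis .
qed

lemma coefficient_0: "coefficient U V 0 = dens U"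
proof -
  have "{S. S \<subseteq> E \<and> card S = 0} = {{}}"
    using finite_edges by (auto simp: card_eq_0_iff dest: finite_subset)
  then show ?thesis by (simp add: coefficient_def mixed_def hom_density_edge_point)
qed

lemma coefficient_top: "coefficient U V (card E) = dens V"
proof -
  have "{S. S \<subseteq> E \<and> card S = card E} = {E}"
    using finite_edges by (auto dest: card_subset_eq)
  then show ?thesis by (simp add: coefficient_def mixed_def hom_density_edge_point)
qed

lemma coefficient_1: "(\<And>e. e \<in> E \<Longrightarrow> mixed U V {e} = 0) \<Longrightarrow> coefficient U V 1 = 0"
  unfolding coefficient_def by (intro sum.neutral) (auto simp: card_1_singleton_iff)

lemma gnorm_nonneg: "0 \<le> gnorm W"
  by (simp add: graph_norm_def)

lemma gnorm_eq_0: "kernel M W \<Longrightarrow> gnorm W = 0 \<longleftrightarrow> (AE z in M \<Otimes>\<^sub>M M. W z = 0)"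
  using norming by (simp add: norming_def norm_on_kernels_def)

lemma gnorm_scale: "kernel M W \<Longrightarrow> gnorm (\<lambda>z. c * W z) = \<bar>c\<bar> * gnorm W"
  using norming by (simp add: norming_def norm_on_kernels_def)

lemma gnorm_triangle: "kernel M U \<Longrightarrow> kernel M W \<Longrightarrow> gnorm (\<lambda>z. U z + W z) \<le> gnorm U + gnorm W"
  using norming by (simp add: norming_def norm_on_kernels_def)

text \<open>The difference has norm 0 by definiteness, so the triangle inequality bounds each norm
  by the other.\<close>

lemma gnorm_AE_cong:
  assumes "kernel M U" "kernel M W" "AE z in M \<Otimes>\<^sub>M M. U z = W z"
  shows "gnorm U = gnorm W"
proof -
  have le: "gnorm U \<le> gnorm W"
    if "kernel M U" "kernel M W" "AE z in M \<Otimes>\<^sub>M M. U z = W z" for U W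
  proof -
    have "gnorm U \<le> gnorm W + gnorm (\<lambda>z. U z - W z)"
      using gnorm_triangle[OF that(2) kernel_diff[OF that(1,2)]] by simp
    then show ?thesis
      using gnorm_eq_0[OF kernel_diff[OF that(1,2)]] that(3) by simp
  qed
  show ?thesis using le[OF assms] le[OF assms(2,1)] assms(3) by (simp add: eq_commute)
qed

lemma gnorm_convex:
  assumes "kernel M U" "kernel M V" "0 \<le> t" "t \<le> 1"
  shows "gnorm (\<lambda>z. U z + t * V z) \<le> (1 - t) * gnorm U + t * gnorm (\<lambda>z. U z + V z)"
proof -
  have "gnorm (\<lambda>z. U z + t * V z) = gnorm (\<lambda>z. (1 - t) * U z + t * (U z + V z))"
    by (simp add: algebra_simps)
  also have "\<dots> \<le> gnorm (\<lambda>z. (1 - t) * U z) + gnorm (\<lambda>z. t * (U z + V z))"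
    using assms by (intro gnorm_triangle kernel_scale kernel_add)
  also have "\<dots> = (1 - t) * gnorm U + t * gnorm (\<lambda>z. U z + V z)"
    using assms by (simp add: gnorm_scale kernel_add)
  finally show ?thesis .
qed

lemma kernel_midpoint: "kernel M U \<Longrightarrow> kernel M W \<Longrightarrow> kernel M (\<lambda>z. (U z + W z) / 2)"
  using kernel_affine[of M U W "1/2" "1/2"] by (simp add: field_simps)

lemma gnorm_midpoint:
  assumes "kernel M U" "kernel M W"
  shows "gnorm (\<lambda>z. (U z + W z) / 2) \<le> (gnorm U + gnorm W) / 2"
  using gnorm_convex[OF assms(1) kernel_diff[OF assms(2,1)], of "1/2"] by (simp add: field_simps)

text \<open>Without edges the functional takes the value 1 at the zero kernel, against
  definiteness.\<close>

lemma card_edges_pos: "0 < card E"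
proof (rule ccontr)
  assume "\<not> 0 < card E"
  then have "E = {}" using finite_edges by simp
  then have "gnorm (\<lambda>_. 0) = 1"
    by (simp add: graph_norm_def hom_density_def vertices.prob_space)
  then show False using gnorm_eq_0[OF kernel_const[of M 0]] by simp
qed

lemma gnorm_power: "gnorm W ^ card E = \<bar>dens W\<bar>"
\<comment> \<open>\<open>powr_realpow\<close> asks for a positive base. If the density is 0, both
  sides vanish because \<open>card E > 0\<close>.\<close>
proof (cases "dens W = 0")
  case False
  then have "gnorm W > 0" by (simp add: graph_norm_def)
  then have "gnorm W ^ card E = gnorm W powr real (card E)" by (simp add: powr_realpow)
  also have "\<dots> = \<bar>dens W\<bar>"
    using card_edges_pos False by (simp add: graph_norm_def powr_powr)
  finally show ?thesis .
qed (use card_edges_pos in \<open>simp add: graph_norm_def\<close>)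

lemma dens_graphon_nonneg: "graphon M W \<Longrightarrow> 0 \<le> dens W"
  unfolding hom_density_edge_point
  by (intro integral_nonneg_AE AE_I2 prod_nonneg ballI graphon_bounds(1)[of M] edge_point_space)

text \<open>On graphons the absolute value in the norm has no effect, so convexity of the norm
  carries over to the density there.\<close>

lemma dens_graphon: "graphon M W \<Longrightarrow> dens W = gnorm W ^ card E"
  using dens_graphon_nonneg[of W] by (simp add: gnorm_power)

text \<open>The products over the edges are dominated by \<open>C ^ card E\<close>. Together with
  \<open>kernel_midpoint_closed_limit\<close> this continuity makes norm bounds survive in the
  limit.\<close>

lemma gnorm_AE_tendsto:
  assumes "\<And>k. kernel M (u k)" "kernel M V"
    and "\<And>k z. z \<in> space (M \<Otimes>\<^sub>M M) \<Longrightarrow> \<bar>u k z\<bar> \<le> C"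
    and "AE z in M \<Otimes>\<^sub>M M. (\<lambda>k. u k z) \<longlonglongrightarrow> V z"
  shows "(\<lambda>k. gnorm (u k)) \<longlonglongrightarrow> gnorm V"
proof -
  have "(\<lambda>k. dens (u k)) \<longlonglongrightarrow> dens V"
    unfolding hom_density_edge_point
  proof (rule integral_dominated_convergence[where w = "\<lambda>_. C ^ card E"])
    show "AE x in vertex_space. (\<lambda>k. \<Prod>e\<in>E. u k (edge_point x e)) \<longlonglongrightarrow> (\<Prod>e\<in>E. V (edge_point x e))"
      using AE_edge_point[OF assms(4)] by eventually_elim (auto intro!: tendsto_prod)
    show "AE x in vertex_space. norm (\<Prod>e\<in>E. u k (edge_point x e)) \<le> C ^ card E" for k
      unfolding real_norm_def abs_prod prod_constant[symmetric]
      by (intro AE_I2 prod_mono conjI abs_ge_zero assms(3) edge_point_space)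
  qed (use assms integrable_edge_prod[of E] in auto)
  then have "(\<lambda>k. \<bar>dens (u k)\<bar> powr (1 / real (card E))) \<longlonglongrightarrow> \<bar>dens V\<bar> powr (1 / real (card E))"
    using card_edges_pos by (intro tendsto_powr2 tendsto_rabs tendsto_const) auto
  then show ?thesis by (simp add: graph_norm_def)
qed

lemma dens_pullback:
  assumes "mp_bij M \<phi>" "kernel M W"
  shows "dens (pullback \<phi> W) = dens W"
proof -
  have [measurable]: "\<phi> \<in> measurable M M" and d: "distr M M \<phi> = M"
    using assms(1) by (auto simp: mp_bij_def)
  \<comment> \<open>\<open>compose\<close> applies \<open>\<phi>\<close> to every coordinate and
    keeps the tuples extensional, as points of the product space must be.\<close>
  have "distr vertex_space vertex_space (compose {..<n} \<phi>) = PiM {..<n} (\<lambda>i. distr M M \<phi>)"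
    by (intro distr_PiM_finite_prob_space') (auto simp: prob_space_axioms)
  then have D: "distr vertex_space vertex_space (compose {..<n} \<phi>) = vertex_space" by (simp add: d)
  have meas: "compose {..<n} \<phi> \<in> measurable vertex_space vertex_space"
    unfolding compose_def by measurable
  have "dens W = (\<integral>x. (\<Prod>e\<in>E. W (edge_point x e)) \<partial>distr vertex_space vertex_space (compose {..<n} \<phi>))"
    by (simp add: D hom_density_edge_point)
  also have "\<dots> = (\<integral>x. (\<Prod>e\<in>E. W (edge_point (compose {..<n} \<phi> x) e)) \<partial>vertex_space)"
    using assms by (intro integral_distr meas borel_measurable_prod kernel_edge_measurable)
  also have "\<dots> = dens (pullback \<phi> W)"
    unfolding hom_density_edge_point
    using edge_ends by (intro Bochner_Integration.integral_cong prod.cong refl)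
      (simp add: edge_point_def compose_def pullback_def)
  finally show ?thesis by simp
qed

lemma gnorm_pullback: "mp_bij M \<phi> \<Longrightarrow> kernel M W \<Longrightarrow> gnorm (pullback \<phi> W) = gnorm W"
  by (simp add: graph_norm_def dens_pullback)

end

section \<open>The norm and weak* convergence\<close>

context norming_graph
begin

text \<open>If kernels of arbitrarily small norm had integral at least \<open>\<epsilon>\<close>
  over \<open>A\<close>, a limit of such kernels would have norm 0, hence vanish almost everywhere,
  and still have integral at least \<open>\<epsilon>\<close>.\<close>

lemma gnorm_null_weak_star:
  assumes ker: "\<And>k. kernel M (V k)"
    and bd: "\<And>k z. z \<in> space (M \<Otimes>\<^sub>M M) \<Longrightarrow> \<bar>V k z\<bar> \<le> C"
    and null: "(\<lambda>k. gnorm (V k)) \<longlonglongrightarrow> 0"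
    and A: "A \<in> sets (M \<Otimes>\<^sub>M M)"
  shows "(\<lambda>k. set_lebesgue_integral (M \<Otimes>\<^sub>M M) A (V k)) \<longlonglongrightarrow> 0"
proof (rule LIMSEQ_I)
  fix \<epsilon> :: real assume "0 < \<epsilon>"
  let ?I = "set_lebesgue_integral (M \<Otimes>\<^sub>M M) A"
  \<comment> \<open>The condition on the integral is one-sided: with an absolute value the set would
    not be closed under midpoints.\<close>
  define K where "K k = {u. kernel M u \<and> (\<forall>z\<in>space (M \<Otimes>\<^sub>M M). \<bar>u z\<bar> \<le> C) \<and>
    gnorm u \<le> inverse (real (Suc k)) \<and> \<epsilon> \<le> ?I u}" for k
  have "\<exists>k. K k = {}"
  proof (rule ccontr)
    assume ne: "\<nexists>k. K k = {}"
    have mid: "(\<lambda>z. (u z + v z) / 2) \<in> K k" if uv: "u \<in> K k" "v \<in> K k" for u v k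
    proof -
      have ker: "kernel M u" "kernel M v" using uv by (auto simp: K_def)
      have "?I (\<lambda>z. (u z + v z) / 2) = (?I u + ?I v) / 2"
        using kernel_set_integrable[OF ker(1) A] kernel_set_integrable[OF ker(2) A] by simp
      moreover have "\<bar>(u z + v z) / 2\<bar> \<le> C" if "z \<in> space (M \<Otimes>\<^sub>M M)" for z
      proof -
        have "\<bar>u z\<bar> \<le> C" "\<bar>v z\<bar> \<le> C" using uv that by (auto simp: K_def)
        then show ?thesis by (simp add: abs_le_iff)
      qed
      ultimately show ?thesis
        using uv kernel_midpoint[OF ker] gnorm_midpoint[OF ker] by (auto simp: K_def)
    qed
    have dec: "decseq K"
    proof (intro decseq_SucI subsetI)
      fix k u assume "u \<in> K (Suc k)"
      moreover have "inverse (real (Suc (Suc k))) \<le> inverse (real (Suc k))" by simp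
      ultimately show "u \<in> K k" unfolding K_def by (auto intro: order_trans)
    qed
    have Kker: "kernel M u" and Kbd: "\<And>z. z \<in> space (M \<Otimes>\<^sub>M M) \<Longrightarrow> \<bar>u z\<bar> \<le> C"
      if "u \<in> K 0" for u
      using that by (auto simp: K_def)
    obtain u L where u: "\<And>k. u k \<in> K k" and L: "kernel M L"
      and lim: "AE z in M \<Otimes>\<^sub>M M. (\<lambda>k. u k z) \<longlonglongrightarrow> L z"
      by (rule kernel_midpoint_closed_limit[of K C])
        (use ne dec Kker Kbd mid in \<open>blast+\<close>)
    have uker: "kernel M (u k)" and ubd: "\<And>z. z \<in> space (M \<Otimes>\<^sub>M M) \<Longrightarrow> \<bar>u k z\<bar> \<le> C" for k
      using u[of k] by (auto simp: K_def)
    have "(\<lambda>k. gnorm (u k)) \<longlonglongrightarrow> 0"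
      by (rule tendsto_sandwich[OF _ _ tendsto_const LIMSEQ_inverse_real_of_nat])
        (use u in \<open>auto simp: K_def gnorm_nonneg\<close>)
    with gnorm_AE_tendsto[OF uker L ubd lim] have "gnorm L = 0" by (rule LIMSEQ_unique)
    then have "AE z in M \<Otimes>\<^sub>M M. L z = 0" using gnorm_eq_0[OF L] by simp
    then have "?I L = 0"
      unfolding set_lebesgue_integral_def by (intro integral_eq_zero_AE) auto
    moreover have "\<epsilon> \<le> ?I L"
      by (rule LIMSEQ_le_const[OF set_integral_AE_tendsto[OF uker L A ubd lim]])
        (use u in \<open>auto simp: K_def\<close>)
    ultimately show False using \<open>0 < \<epsilon>\<close> by simp
  qed
  then obtain k where k: "K k = {}" by blast
  have "eventually (\<lambda>j. gnorm (V j) < inverse (real (Suc k))) sequentially"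
    using null by (rule order_tendstoD) simp
  then have "eventually (\<lambda>j. norm (?I (V j) - 0) < \<epsilon>) sequentially"
  proof eventually_elim
    case (elim j)
    \<comment> \<open>Negation preserves the norm, so the one-sided bound for both
      \<open>V j\<close> and its negative bounds the absolute value.\<close>
    have "kernel M (\<lambda>z. - V j z)" "gnorm (\<lambda>z. - V j z) = gnorm (V j)"
      using kernel_scale[OF ker[of j], of "-1"] gnorm_scale[OF ker[of j], of "-1"] by auto
    moreover have "?I (\<lambda>z. - V j z) = - ?I (V j)" by (simp add: set_lebesgue_integral_def)
    moreover have "V j \<notin> K k" "(\<lambda>z. - V j z) \<notin> K k" using k by auto
    ultimately show ?case using elim ker bd by (auto simp: K_def)
  qed
  then show "\<exists>no. \<forall>j\<ge>no. norm (?I (V j) - 0) < \<epsilon>" by (simp add: eventually_sequentially)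
qed

text \<open>A sublevel set of the norm is convex and closed under bounded almost everywhere
  convergence. If infinitely many \<open>\<Gamma> k\<close> had norm at most \<open>c\<close>, the
  Mazur-type limit would do so too and would agree with \<open>W\<close> almost everywhere.\<close>

lemma gnorm_weak_star_lower_semicontinuous:
  assumes W: "kernel M W" and ker: "\<And>k. kernel M (\<Gamma> k)"
    and bd: "\<And>k z. z \<in> space (M \<Otimes>\<^sub>M M) \<Longrightarrow> \<bar>\<Gamma> k z\<bar> \<le> C"
    and conv: "weak_star_conv M \<Gamma> W" and c: "c < gnorm W"
  shows "eventually (\<lambda>k. c < gnorm (\<Gamma> k)) sequentially"
proof (rule ccontr)
  assume "\<not> eventually (\<lambda>k. c < gnorm (\<Gamma> k)) sequentially"
  then have freq: "\<exists>j\<ge>k. gnorm (\<Gamma> j) \<le> c" for k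
    by (auto simp: eventually_sequentially not_less)
  let ?I = "\<lambda>S T. set_lebesgue_integral (M \<Otimes>\<^sub>M M) (S \<times> T)"
  \<comment> \<open>A convex set containing the members of norm at most \<open>c\<close> of the \<open>k\<close>-th tail, on which every
    rectangle integral is as close to that of \<open>W\<close> as on that tail.\<close>
  define K where "K k = {u. kernel M u \<and> (\<forall>z\<in>space (M \<Otimes>\<^sub>M M). \<bar>u z\<bar> \<le> C) \<and> gnorm u \<le> c \<and>
    (\<forall>S\<in>sets M. \<forall>T\<in>sets M. \<forall>b. (\<forall>j\<ge>k. \<bar>?I S T (\<Gamma> j) - ?I S T W\<bar> \<le> b) \<longrightarrow>
      \<bar>?I S T u - ?I S T W\<bar> \<le> b)}" for k
  have ne: "K k \<noteq> {}" for k
    using freq[of k] ker bd by (auto simp: K_def)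
  have dec: "decseq K"
    by (intro decseq_SucI) (auto simp: K_def)
  have mid: "(\<lambda>z. (u z + v z) / 2) \<in> K k" if uv: "u \<in> K k" "v \<in> K k" for u v k
  proof -
    have ker: "kernel M u" "kernel M v" using uv by (auto simp: K_def)
    have I: "?I S T (\<lambda>z. (u z + v z) / 2) = (?I S T u + ?I S T v) / 2"
      if "S \<in> sets M" "T \<in> sets M" for S T
      using kernel_set_integrable[OF ker(1), of "S \<times> T"] kernel_set_integrable[OF ker(2), of "S \<times> T"] that
      by simp
    have "\<bar>(u z + v z) / 2\<bar> \<le> C" if "z \<in> space (M \<Otimes>\<^sub>M M)" for z
    proof -
      have "\<bar>u z\<bar> \<le> C" "\<bar>v z\<bar> \<le> C" using uv that by (auto simp: K_def)
      then show ?thesis by (simp add: abs_le_iff)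
    qed
    moreover have "\<bar>?I S T (\<lambda>z. (u z + v z) / 2) - ?I S T W\<bar> \<le> b"
      if ST: "S \<in> sets M" "T \<in> sets M" and b: "\<forall>j\<ge>k. \<bar>?I S T (\<Gamma> j) - ?I S T W\<bar> \<le> b" for S T b
    proof -
      have "\<bar>?I S T u - ?I S T W\<bar> \<le> b" "\<bar>?I S T v - ?I S T W\<bar> \<le> b"
        using uv ST b by (auto simp: K_def)
      then show ?thesis unfolding I[OF ST] by argo
    qed
    moreover have "gnorm (\<lambda>z. (u z + v z) / 2) \<le> c"
      using gnorm_midpoint[OF ker] uv by (auto simp: K_def)
    ultimately show ?thesis using kernel_midpoint[OF ker] by (simp add: K_def)
  qed
  have Kker: "kernel M u" and Kbd: "\<And>z. z \<in> space (M \<Otimes>\<^sub>M M) \<Longrightarrow> \<bar>u z\<bar> \<le> C"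
    if "u \<in> K 0" for u
    using that by (auto simp: K_def)
  obtain u L where u: "\<And>k. u k \<in> K k" and L: "kernel M L"
    and lim: "AE z in M \<Otimes>\<^sub>M M. (\<lambda>k. u k z) \<longlonglongrightarrow> L z"
    by (rule kernel_midpoint_closed_limit[of K C])
      (use ne dec Kker Kbd mid in \<open>blast+\<close>)
  have uker: "kernel M (u k)" and ubd: "\<And>z. z \<in> space (M \<Otimes>\<^sub>M M) \<Longrightarrow> \<bar>u k z\<bar> \<le> C"
    and uc: "gnorm (u k) \<le> c" for k
    using u[of k] by (auto simp: K_def)
  have "?I S T L = ?I S T W" if ST: "S \<in> sets M" "T \<in> sets M" for S T
  proof (rule LIMSEQ_unique)
    show "(\<lambda>k. ?I S T (u k)) \<longlonglongrightarrow> ?I S T L"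
      by (rule set_integral_AE_tendsto[OF uker L _ ubd lim]) (use ST in auto)
    show "(\<lambda>k. ?I S T (u k)) \<longlonglongrightarrow> ?I S T W"
    proof (rule LIMSEQ_I)
      fix e :: real assume "0 < e"
      \<comment> \<open>Membership in \<open>K k\<close> yields only non-strict bounds, so
        \<open>e / 2\<close> is used to stay below \<open>e\<close>.\<close>
      then obtain k0 where k0: "\<And>j. j \<ge> k0 \<Longrightarrow> \<bar>?I S T (\<Gamma> j) - ?I S T W\<bar> < e / 2"
        using conv ST LIMSEQ_D[of "\<lambda>k. ?I S T (\<Gamma> k)" "?I S T W" "e / 2"]
        unfolding weak_star_conv_def by auto
      have "\<bar>?I S T (u k) - ?I S T W\<bar> \<le> e / 2" if "k \<ge> k0" for k
      proof -
        have "\<forall>j\<ge>k. \<bar>?I S T (\<Gamma> j) - ?I S T W\<bar> \<le> e / 2"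
          using k0 that by (meson less_imp_le order_trans)
        then show ?thesis using u[of k] ST unfolding K_def by blast
      qed
      then show "\<exists>k0. \<forall>k\<ge>k0. norm (?I S T (u k) - ?I S T W) < e"
        using \<open>0 < e\<close> by (intro exI[of _ k0]) (force simp: real_norm_def)
    qed
  qed
  then have "AE z in M \<Otimes>\<^sub>M M. L z = W z"
    by (intro AE_eq_if_set_integral_Times_eq kernel_integrable L W)
  then have "gnorm L = gnorm W" by (rule gnorm_AE_cong[OF L W])
  moreover have "gnorm L \<le> c"
    by (rule LIMSEQ_le_const2[OF gnorm_AE_tendsto[OF uker L ubd lim]]) (use uc in auto)
  ultimately show False using c by simp
qed

text \<open>Convergence of the polynomials in \<open>t\<close> to a constant forces the top
  coefficient, which is the density of \<open>V k\<close>, to tend to 0.\<close>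

lemma gnorm_null_if_dens_tendsto_on_segments:
  assumes ker: "kernel M U" "\<And>k. kernel M (V k)"
    and lim: "\<And>t. 0 \<le> t \<Longrightarrow> t \<le> 1 \<Longrightarrow> (\<lambda>k. dens (\<lambda>z. U z + t * V k z)) \<longlonglongrightarrow> dens U"
  shows "(\<lambda>k. gnorm (V k)) \<longlonglongrightarrow> 0"
proof -
  let ?m = "card E"
  define a where "a k j = coefficient U (V k) j - (if j = 0 then dens U else 0)" for k j
  have "(\<lambda>k. a k ?m) \<longlonglongrightarrow> 0"
  proof (rule coeffs_tendsto_zero)
    fix t :: real assume t: "0 \<le> t" "t \<le> 1"
    have "(\<Sum>j\<le>?m. a k j * t ^ j) = dens (\<lambda>z. U z + t * V k z) - dens U" for k
    proof -
      have "(\<Sum>j\<le>?m. a k j * t ^ j) =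
          (\<Sum>j\<le>?m. coefficient U (V k) j * t ^ j) - (\<Sum>j\<le>?m. if j = 0 then dens U else 0)"
        unfolding sum_subtractf[symmetric] by (intro sum.cong) (auto simp: a_def algebra_simps)
      then show ?thesis using dens_line[OF ker(1) ker(2)[of k], of t] by simp
    qed
    with tendsto_diff[OF lim[OF t] tendsto_const[of "dens U"]]
    show "(\<lambda>k. \<Sum>j\<le>?m. a k j * t ^ j) \<longlonglongrightarrow> 0" by simp
  qed simp
  \<comment> \<open>Since \<open>card E > 0\<close>, the constant subtracted in \<open>a\<close>
    does not touch the top coefficient.\<close>
  then have "(\<lambda>k. \<bar>dens (V k)\<bar> powr (1 / real ?m)) \<longlonglongrightarrow> \<bar>0\<bar> powr (1 / real ?m)"
    using card_edges_pos
    by (intro tendsto_powr2 tendsto_rabs tendsto_const) (auto simp: a_def coefficient_top)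
  then show ?thesis by (simp add: graph_norm_def)
qed

text \<open>The Radon-Riesz property. The points \<open>X k\<close> at a fixed parameter
  \<open>t\<close> of the segments from \<open>W\<close> to \<open>\<Gamma> k\<close> also converge
  weak* to \<open>W\<close>. Semicontinuity bounds their norms from below and convexity from above,
  so their densities tend to that of \<open>W\<close>.\<close>

lemma gnorm_weak_star_Radon_Riesz:
  assumes gr: "graphon M W" "\<And>k. graphon M (\<Gamma> k)"
    and conv: "weak_star_conv M \<Gamma> W" and le: "\<And>k. gnorm (\<Gamma> k) \<le> gnorm W"
  shows "(\<lambda>k. gnorm (\<lambda>z. \<Gamma> k z - W z)) \<longlonglongrightarrow> 0"
proof (rule gnorm_null_if_dens_tendsto_on_segments[of W])
  note ker = graphon_kernel[OF gr(1)] graphon_kernel[OF gr(2)]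
  show "kernel M W" "kernel M (\<lambda>z. \<Gamma> k z - W z)" for k
    by (intro ker kernel_diff)+
  fix t :: real assume t: "0 \<le> t" "t \<le> 1"
  define X where "X k z = W z + t * (\<Gamma> k z - W z)" for k z
  have X: "graphon M (X k)" for k
    unfolding X_def using gr t by (intro graphon_segment kernel_diff ker) auto
  have "weak_star_conv M X W"
    unfolding weak_star_conv_def
  proof (intro ballI)
    fix S T assume ST: "S \<in> sets M" "T \<in> sets M"
    let ?I = "set_lebesgue_integral (M \<Otimes>\<^sub>M M) (S \<times> T)"
    have "S \<times> T \<in> sets (M \<Otimes>\<^sub>M M)" using ST by simp
    note int = kernel_set_integrable[OF ker(1) this] kernel_set_integrable[OF ker(2) this]
    have "?I (X k) = ?I W + t * (?I (\<Gamma> k) - ?I W)" for k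
      unfolding X_def using int by (simp add: set_integral_diff)
    moreover have "(\<lambda>k. ?I W + t * (?I (\<Gamma> k) - ?I W)) \<longlonglongrightarrow> ?I W + t * (?I W - ?I W)"
      using conv ST by (intro tendsto_intros) (auto simp: weak_star_conv_def)
    ultimately show "(\<lambda>k. ?I (X k)) \<longlonglongrightarrow> ?I W" by simp
  qed
  have "(\<lambda>k. gnorm (X k)) \<longlonglongrightarrow> gnorm W"
  proof (rule order_tendstoI)
    fix c assume "c < gnorm W"
    then show "eventually (\<lambda>k. c < gnorm (X k)) sequentially"
      using graphon_bounds[OF X] \<open>weak_star_conv M X W\<close>
      by (intro gnorm_weak_star_lower_semicontinuous[OF ker(1) graphon_kernel[OF X], where C = 1]) auto
  next
    fix c assume c: "gnorm W < c"
    have "gnorm (X k) \<le> gnorm W" for k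
    proof -
      have "gnorm (X k) \<le> (1 - t) * gnorm W + t * gnorm (\<Gamma> k)"
        unfolding X_def using gnorm_convex[OF ker(1) kernel_diff[OF ker(2) ker(1)] t, of k] by simp
      also have "\<dots> \<le> (1 - t) * gnorm W + t * gnorm W"
        using t le by (intro add_left_mono mult_left_mono) auto
      finally show ?thesis by (simp add: algebra_simps)
    qed
    then show "eventually (\<lambda>k. gnorm (X k) < c) sequentially"
      using c by (auto intro: always_eventually le_less_trans)
  qed
  then have "(\<lambda>k. gnorm (X k) ^ card E) \<longlonglongrightarrow> gnorm W ^ card E" by (rule tendsto_power)
  then show "(\<lambda>k. dens (\<lambda>z. W z + t * (\<Gamma> k z - W z))) \<longlonglongrightarrow> dens W"
    unfolding dens_graphon[OF gr(1)] dens_graphon[OF X, symmetric] by (simp add: X_def[abs_def])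
qed

text \<open>If \<open>W\<^sub>1\<close> is close to \<open>W\<^sub>2\<close> moved by
  \<open>\<pi> k\<close>, then by invariance of the norm \<open>W\<^sub>1\<close> moved by
  \<open>\<tau> k\<close>, the inverse of \<open>\<pi> k\<close> after \<open>\<rho> k\<close>, is
  equally close to \<open>W\<^sub>2\<close> moved by \<open>\<rho> k\<close>. Both sequences then
  have the same weak* limit.\<close>

lemma envelope_subset_if_gnorm_null:
  assumes gr: "graphon M W\<^sub>1" "graphon M W\<^sub>2" and \<pi>: "\<And>k. mp_bij M (\<pi> k)"
    and null: "(\<lambda>k. gnorm (\<lambda>z. pullback (\<pi> k) W\<^sub>2 z - W\<^sub>1 z)) \<longlonglongrightarrow> 0"
  shows "envelope M W\<^sub>2 \<subseteq> envelope M W\<^sub>1"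
proof
  fix U assume "U \<in> envelope M W\<^sub>2"
  then obtain \<rho> where U: "graphon M U" and \<rho>: "\<And>k. mp_bij M (\<rho> k)"
    and conv: "weak_star_conv M (\<lambda>k. pullback (\<rho> k) W\<^sub>2) U"
    by (auto simp: envelope_def)
  have "\<forall>k. \<exists>\<psi>. mp_bij M \<psi> \<and> (\<forall>x\<in>space M. \<pi> k (\<psi> x) = x)"
    using mp_bij_inverse[OF \<pi>] by metis
  then obtain \<sigma> where \<sigma>: "\<And>k. mp_bij M (\<sigma> k)" and inv: "\<And>k x. x \<in> space M \<Longrightarrow> \<pi> k (\<sigma> k x) = x"
    by metis
  define \<tau> where "\<tau> k = \<sigma> k \<circ> \<rho> k" for k
  have \<tau>: "mp_bij M (\<tau> k)" for k unfolding \<tau>_def by (intro mp_bij_comp \<sigma> \<rho>)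
  note ker = graphon_kernel[OF gr(1)] graphon_kernel[OF gr(2)]
  define V where "V k z = pullback (\<rho> k) W\<^sub>2 z - pullback (\<tau> k) W\<^sub>1 z" for k z
  have Vker: "kernel M (V k)" for k
    unfolding V_def by (intro kernel_diff kernel_pullback \<rho> \<tau> ker)
  \<comment> \<open>\<open>\<sigma> k\<close> inverts \<open>\<pi> k\<close> only on
    \<open>space M\<close>, so the two kernels are compared there and not as functions.\<close>
  have "gnorm (V k) = gnorm (pullback (\<tau> k) (\<lambda>z. pullback (\<pi> k) W\<^sub>2 z - W\<^sub>1 z))" for k
  proof (rule gnorm_AE_cong[OF Vker])
    show "kernel M (pullback (\<tau> k) (\<lambda>z. pullback (\<pi> k) W\<^sub>2 z - W\<^sub>1 z))"
      by (intro kernel_pullback \<tau> kernel_diff \<pi> ker)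
    show "AE z in M \<Otimes>\<^sub>M M. V k z = pullback (\<tau> k) (\<lambda>z. pullback (\<pi> k) W\<^sub>2 z - W\<^sub>1 z) z"
      using inv mp_bij_space[OF \<rho>]
      by (intro AE_I2) (auto simp: V_def \<tau>_def pullback_def space_pair_measure)
  qed
  then have "(\<lambda>k. gnorm (V k)) \<longlonglongrightarrow> 0"
    using null by (simp add: gnorm_pullback[OF \<tau> kernel_diff[OF kernel_pullback[OF \<pi> ker(2)] ker(1)]])
  moreover have "\<bar>V k z\<bar> \<le> 1" if "z \<in> space (M \<Otimes>\<^sub>M M)" for k z
    using graphon_bounds[OF graphon_pullback[OF \<rho> gr(2)] that, of k]
      graphon_bounds[OF graphon_pullback[OF \<tau> gr(1)] that, of k] by (simp add: V_def abs_le_iff)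
  ultimately have V0: "(\<lambda>k. set_lebesgue_integral (M \<Otimes>\<^sub>M M) A (V k)) \<longlonglongrightarrow> 0"
    if "A \<in> sets (M \<Otimes>\<^sub>M M)" for A
    using that by (intro gnorm_null_weak_star[OF Vker, where C = 1]) auto
  have "weak_star_conv M (\<lambda>k. pullback (\<tau> k) W\<^sub>1) U"
    unfolding weak_star_conv_def
  proof (intro ballI)
    fix S T assume ST: "S \<in> sets M" "T \<in> sets M"
    let ?I = "set_lebesgue_integral (M \<Otimes>\<^sub>M M) (S \<times> T)"
    have A: "S \<times> T \<in> sets (M \<Otimes>\<^sub>M M)" using ST by simp
    have "?I (V k) = ?I (pullback (\<rho> k) W\<^sub>2) - ?I (pullback (\<tau> k) W\<^sub>1)" for k
      unfolding V_def
      by (intro set_integral_diff kernel_set_integrable A kernel_pullback \<rho> \<tau> ker)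
    moreover have "(\<lambda>k. ?I (pullback (\<rho> k) W\<^sub>2) - ?I (V k)) \<longlonglongrightarrow> ?I U - 0"
      using conv ST by (intro tendsto_diff V0[OF A]) (auto simp: weak_star_conv_def)
    ultimately show "(\<lambda>k. ?I (pullback (\<tau> k) W\<^sub>1)) \<longlonglongrightarrow> ?I U" by simp
  qed
  then show "U \<in> envelope M W\<^sub>1" using U \<tau> by (auto simp: envelope_def)
qed

lemma cut_distance_identifying_dens: "cut_distance_identifying M dens"
  unfolding cut_distance_identifying_def
proof (intro allI impI)
  fix W\<^sub>1 W\<^sub>2 assume gr: "graphon M W\<^sub>1" "graphon M W\<^sub>2" and less: "struct_less M W\<^sub>1 W\<^sub>2"
  \<comment> \<open>The constant sequence of identities puts \<open>W\<^sub>1\<close> into its own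
    envelope.\<close>
  have "pullback (\<lambda>x. x) W\<^sub>1 = W\<^sub>1" by (auto simp: pullback_def)
  then have "W\<^sub>1 \<in> envelope M W\<^sub>1"
    using gr(1) mp_bij_id[of M]
    by (auto simp: envelope_def weak_star_conv_def intro!: exI[of _ "\<lambda>_ x. x"])
  then have "W\<^sub>1 \<in> envelope M W\<^sub>2"
    using less by (auto simp: struct_less_def struct_le_def)
  then obtain \<pi> where \<pi>: "\<And>k. mp_bij M (\<pi> k)" and conv: "weak_star_conv M (\<lambda>k. pullback (\<pi> k) W\<^sub>2) W\<^sub>1"
    by (auto simp: envelope_def)
  note inv = gnorm_pullback[OF \<pi> graphon_kernel[OF gr(2)]]
  have "gnorm W\<^sub>1 < gnorm W\<^sub>2"
  proof (rule ccontr)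
    \<comment> \<open>All versions of \<open>W\<^sub>2\<close> have the norm of
      \<open>W\<^sub>2\<close>, now at most that of \<open>W\<^sub>1\<close>. This is the norm bound
      required by the Radon-Riesz property.\<close>
    assume "\<not> gnorm W\<^sub>1 < gnorm W\<^sub>2"
    then have "(\<lambda>k. gnorm (\<lambda>z. pullback (\<pi> k) W\<^sub>2 z - W\<^sub>1 z)) \<longlonglongrightarrow> 0"
      using gr conv by (intro gnorm_weak_star_Radon_Riesz graphon_pullback \<pi>) (auto simp: inv)
    then have "envelope M W\<^sub>2 \<subseteq> envelope M W\<^sub>1" by (rule envelope_subset_if_gnorm_null[OF gr \<pi>])
    with less show False by (simp add: struct_less_def struct_le_def)
  qed
  then show "dens W\<^sub>1 < dens W\<^sub>2"
    unfolding dens_graphon[OF gr(1)] dens_graphon[OF gr(2)]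
    using card_edges_pos by (intro power_strict_mono gnorm_nonneg)
qed

end

section \<open>Steppings\<close>

text \<open>The cells are disjoint, so a single summand of the double sum survives.\<close>

lemma stepping_on_cell:
  assumes P: "partition_on X P" "finite P" and AB: "A \<in> P" "B \<in> P" and z: "z \<in> A \<times> B"
  shows "stepping M P W z =
    set_lebesgue_integral (M \<Otimes>\<^sub>M M) (A \<times> B) W / (measure M A * measure M B)"
proof -
  have eq: "A' = A" if "A' \<in> P" "A \<in> P" "x \<in> A'" "x \<in> A" for A' A x
    using P(1) that by (auto simp: partition_on_def disjoint_def)
  let ?c = "\<lambda>A B. set_lebesgue_integral (M \<Otimes>\<^sub>M M) (A \<times> B) W / (measure M A * measure M B)"
  have ind: "indicat_real (A' \<times> B') z = (if A' = A then if B' = B then 1 else 0 else 0)"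
    if "A' \<in> P" "B' \<in> P" for A' B'
  proof (cases "A' = A \<and> B' = B")
    case False
    then have "z \<notin> A' \<times> B'" using that eq AB z by blast
    with False show ?thesis by auto
  qed (use z in auto)
  have "stepping M P W z = (\<Sum>A'\<in>P. \<Sum>B'\<in>P. if A' = A then if B' = B then ?c A B else 0 else 0)"
    unfolding stepping_def by (intro sum.cong refl) (simp add: ind)
  also have "\<dots> = (\<Sum>A'\<in>P. if A' = A then \<Sum>B'\<in>P. if B' = B then ?c A B else 0 else 0)"
    by (intro sum.cong refl) auto
  also have "\<dots> = ?c A B" using P(2) AB by simp
  finally show ?thesis .
qed

lemma partition_on_square_cell:
  assumes "partition_on (space M) P" "z \<in> space (M \<Otimes>\<^sub>M M)"
  obtains A B where "A \<in> P" "B \<in> P" "z \<in> A \<times> B"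
proof -
  have "fst z \<in> \<Union>P" "snd z \<in> \<Union>P"
    using assms by (auto simp: partition_on_def space_pair_measure)
  then obtain A B where "A \<in> P" "B \<in> P" "fst z \<in> A" "snd z \<in> B" by blast
  then show thesis by (intro that[of A B]) (auto simp: mem_Times_iff)
qed

context prob_space
begin

text \<open>Swapping coordinates preserves the product measure and the kernel. This makes steppings
  symmetric.\<close>

lemma set_integral_kernel_swap:
  assumes W: "kernel M W" and [measurable]: "A \<in> sets M" "B \<in> sets M"
  shows "set_lebesgue_integral (M \<Otimes>\<^sub>M M) (A \<times> B) W = set_lebesgue_integral (M \<Otimes>\<^sub>M M) (B \<times> A) W"
proof -
  interpret pair_sigma_finite M M by unfold_locales
  note [measurable] = kernel_measurable[OF W]
  have "set_lebesgue_integral (M \<Otimes>\<^sub>M M) (A \<times> B) W =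
      (\<integral>(x, y). indicat_real (A \<times> B) (y, x) *\<^sub>R W (y, x) \<partial>(M \<Otimes>\<^sub>M M))"
    unfolding set_lebesgue_integral_def by (subst integral_product_swap) measurable
  also have "\<dots> = set_lebesgue_integral (M \<Otimes>\<^sub>M M) (B \<times> A) W"
    unfolding set_lebesgue_integral_def
    using W by (intro Bochner_Integration.integral_cong refl)
      (auto simp: kernel_def space_pair_measure indicator_def)
  finally show ?thesis .
qed

lemma measure_Times: "A \<in> sets M \<Longrightarrow> B \<in> sets M \<Longrightarrow> measure (M \<Otimes>\<^sub>M M) (A \<times> B) = measure M A * measure M B"
  by (simp add: measure_def emeasure_pair_measure_Times enn2real_mult)

lemma set_integral_Times_const:
  assumes "A \<in> sets M" "B \<in> sets M"
  shows "set_lebesgue_integral (M \<Otimes>\<^sub>M M) (A \<times> B) (\<lambda>_. c :: real) = measure M A * measure M B * c"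
proof -
  interpret Q: prob_space "M \<Otimes>\<^sub>M M" by (rule prob_space_square)
  have "A \<times> B \<in> sets (M \<Otimes>\<^sub>M M)" using assms by simp
  then show ?thesis
    using Q.emeasure_finite by (simp add: set_integral_const measure_Times assms)
qed

lemma set_integral_graphon_bounds:
  assumes W: "graphon M W" and AB: "A \<in> sets M" "B \<in> sets M"
  shows "0 \<le> set_lebesgue_integral (M \<Otimes>\<^sub>M M) (A \<times> B) W"
    and "set_lebesgue_integral (M \<Otimes>\<^sub>M M) (A \<times> B) W \<le> measure M A * measure M B"
proof -
  have S: "A \<times> B \<in> sets (M \<Otimes>\<^sub>M M)" using AB by simp
  show "0 \<le> set_lebesgue_integral (M \<Otimes>\<^sub>M M) (A \<times> B) W"
    unfolding set_lebesgue_integral_def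
    by (intro integral_nonneg_AE AE_I2) (simp add: graphon_bounds[OF W])
  have "set_lebesgue_integral (M \<Otimes>\<^sub>M M) (A \<times> B) W \<le> set_lebesgue_integral (M \<Otimes>\<^sub>M M) (A \<times> B) (\<lambda>_. 1)"
    using sets.sets_into_space[OF S] graphon_bounds[OF W]
    by (intro set_integral_mono kernel_set_integrable kernel_const graphon_kernel[OF W] S) auto
  then show "set_lebesgue_integral (M \<Otimes>\<^sub>M M) (A \<times> B) W \<le> measure M A * measure M B"
    by (simp add: set_integral_Times_const AB)
qed

lemma graphon_stepping:
  assumes W: "graphon M W" and P: "finite P" "partition_on (space M) P" "P \<subseteq> sets M"
  shows "graphon M (stepping M P W)"
proof (rule graphonI)
  let ?c = "\<lambda>A B. set_lebesgue_integral (M \<Otimes>\<^sub>M M) (A \<times> B) W / (measure M A * measure M B)"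
  note cell = stepping_on_cell[OF P(2,1)]
  have PM: "A \<in> sets M" if "A \<in> P" for A using P(3) that by auto
  have bounds: "0 \<le> stepping M P W z \<and> stepping M P W z \<le> 1" if z: "z \<in> space (M \<Otimes>\<^sub>M M)" for z
  proof -
    obtain A B where AB: "A \<in> P" "B \<in> P" "z \<in> A \<times> B"
      using partition_on_square_cell[OF P(2) z] by blast
    \<comment> \<open>This covers null cells as well, where \<open>m = 0\<close> and the quotient is
      0.\<close>
    have "0 \<le> i / m \<and> i / m \<le> 1" if "0 \<le> i" "i \<le> m" for i m :: real
      using that by (auto simp: divide_le_eq_1)
    then show ?thesis
      unfolding cell[OF AB] using set_integral_graphon_bounds[OF W PM PM, OF AB(1,2)] by blast
  qed
  then show "z \<in> space (M \<Otimes>\<^sub>M M) \<Longrightarrow> 0 \<le> stepping M P W z \<and> stepping M P W z \<le> 1" for z .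
  have "stepping M P W \<in> borel_measurable (M \<Otimes>\<^sub>M M)"
    unfolding stepping_def
    by (intro borel_measurable_sum borel_measurable_times borel_measurable_indicator pair_measureI PM
        borel_measurable_const)
  moreover have "stepping M P W (x, y) = stepping M P W (y, x)"
    if xy: "x \<in> space M" "y \<in> space M" for x y
  proof -
    obtain A B where AB: "A \<in> P" "B \<in> P" "(x, y) \<in> A \<times> B"
      using partition_on_square_cell[OF P(2), of "(x, y)"] xy by (auto simp: space_pair_measure)
    then have "(y, x) \<in> B \<times> A" by auto
    then show ?thesis
      by (simp add: cell[OF AB] cell[OF AB(2,1)] mult.commute
          set_integral_kernel_swap[OF graphon_kernel[OF W] PM PM, OF AB(1,2)])
  qed
  moreover have "\<forall>x\<in>space M. \<forall>y\<in>space M. \<bar>stepping M P W (x, y)\<bar> \<le> 1"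
    using bounds by (auto simp: space_pair_measure)
  ultimately show "kernel M (stepping M P W)" unfolding kernel_def by blast
qed

lemma set_integral_stepping:
  assumes W: "graphon M W" and P: "finite P" "partition_on (space M) P" "P \<subseteq> sets M"
    and AB: "A \<in> P" "B \<in> P"
  shows "set_lebesgue_integral (M \<Otimes>\<^sub>M M) (A \<times> B) (stepping M P W) =
    set_lebesgue_integral (M \<Otimes>\<^sub>M M) (A \<times> B) W"
proof -
  let ?i = "set_lebesgue_integral (M \<Otimes>\<^sub>M M) (A \<times> B) W"
  have M: "A \<in> sets M" "B \<in> sets M" using AB P(3) by auto
  have "set_lebesgue_integral (M \<Otimes>\<^sub>M M) (A \<times> B) (stepping M P W) =
      set_lebesgue_integral (M \<Otimes>\<^sub>M M) (A \<times> B) (\<lambda>_. ?i / (measure M A * measure M B))"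
    using M by (intro set_lebesgue_integral_cong ballI allI impI stepping_on_cell[OF P(2,1) AB]) auto
  \<comment> \<open>On a null cell the average is 0 by convention, and the integral of
    \<open>W\<close> is 0 because it is bounded by the measure of the cell.\<close>
  also have "\<dots> = ?i"
    using set_integral_graphon_bounds[OF W M] by (auto simp: set_integral_Times_const M)
  finally show ?thesis .
qed

end

section \<open>Steppings as strict minimizers of the density\<close>

context norming_graph
begin

text \<open>By Fubini, all vertices except the ends of \<open>e\<close> are integrated first. As
  \<open>U\<close> sees only cells, the result \<open>h\<close> depends only on the cells of the two
  ends, so the whole integral is a combination of the vanishing cell integrals of
  \<open>V\<close>.\<close>

lemma mixed_cell_averages_zero:
  assumes P: "finite P" "partition_on (space M) P" "P \<subseteq> sets M"
    and U: "kernel M U"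
    and U_cell: "\<And>A B z z'. A \<in> P \<Longrightarrow> B \<in> P \<Longrightarrow> z \<in> A \<times> B \<Longrightarrow> z' \<in> A \<times> B \<Longrightarrow> U z = U z'"
    and V: "kernel M V"
    and V_cell: "\<And>A B. A \<in> P \<Longrightarrow> B \<in> P \<Longrightarrow> set_lebesgue_integral (M \<Otimes>\<^sub>M M) (A \<times> B) V = 0"
    and e: "e \<in> E"
  shows "mixed U V {e} = 0"
proof -
  interpret fam: product_sigma_finite "\<lambda>_::nat. M" by unfold_locales
  define a b where "a = Min e" and "b = Max e"
  define I J where "I = {a, b}" and "J = {..<n} - {a, b}"
  have ab: "a < n" "b < n" "a \<noteq> b" using edge_ends[OF e] by (auto simp: a_def b_def)
  have IJ: "I \<inter> J = {}" "finite I" "finite J" "I \<union> J = {..<n}"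
    using ab by (auto simp: I_def J_def)
  define G where "G x = (\<Prod>e'\<in>E - {e}. U (edge_point x e'))" for x
  define h where "h x = (\<integral>y. G (merge I J (x, y)) \<partial>PiM J (\<lambda>_. M))" for x
  have "mixed U V {e} = (\<integral>x. V (edge_point x e) * G x \<partial>PiM (I \<union> J) (\<lambda>_. M))"
    by (simp add: mixed_def G_def IJ(4))
  also have "\<dots> = (\<integral>x. (\<integral>y. V (edge_point (merge I J (x, y)) e) * G (merge I J (x, y)) \<partial>PiM J (\<lambda>_. M))
      \<partial>PiM I (\<lambda>_. M))"
    using integrable_mixed[OF U V, of "{e}"] e
    by (intro fam.product_integral_fold IJ(1-3)) (simp add: G_def IJ(4))
  also have "\<dots> = (\<integral>x. V (x a, x b) * h x \<partial>PiM I (\<lambda>_. M))"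
    by (simp add: edge_point_def h_def merge_def I_def flip: a_def b_def)
  finally have fold: "mixed U V {e} = (\<integral>x. V (x a, x b) * h x \<partial>PiM I (\<lambda>_. M))" .

  have h_cell: "h x = h x'"
    if x: "A \<in> P" "B \<in> P" "x a \<in> A" "x' a \<in> A" "x b \<in> B" "x' b \<in> B" for A B x x'
    unfolding h_def
  proof (intro Bochner_Integration.integral_cong refl)
    fix y assume y: "y \<in> space (PiM J (\<lambda>_. M))"
    \<comment> \<open>The merged tuples agree on \<open>J\<close>, and on \<open>I\<close> they lie
      in common cells by assumption, so \<open>U\<close> cannot tell them apart on any edge.\<close>
    have cell: "\<exists>A\<in>P. merge I J (x, y) i \<in> A \<and> merge I J (x', y) i \<in> A" if "i < n" for i
    proof (cases "i \<in> I")
      case True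
      then show ?thesis using x by (auto simp: merge_def I_def)
    next
      case False
      then have "i \<in> J" using that by (auto simp: I_def J_def)
      then have "y i \<in> space M" using y by (auto simp: space_PiM)
      then obtain A where "A \<in> P" "y i \<in> A" using P(2) by (auto simp: partition_on_def)
      then show ?thesis using \<open>i \<in> J\<close> False by (auto simp: merge_def)
    qed
    show "G (merge I J (x, y)) = G (merge I J (x', y))"
      unfolding G_def
    proof (intro prod.cong refl)
      fix e' assume "e' \<in> E - {e}"
      then have "Min e' < n" "Max e' < n" using edge_ends[of e'] by auto
      from cell[OF this(1)] cell[OF this(2)]
      obtain A B where "A \<in> P" "B \<in> P" "edge_point (merge I J (x, y)) e' \<in> A \<times> B"
        "edge_point (merge I J (x', y)) e' \<in> A \<times> B"
        by (auto simp: edge_point_def)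
      then show "U (edge_point (merge I J (x, y)) e') = U (edge_point (merge I J (x', y)) e')"
        by (rule U_cell)
    qed
  qed
  define r where "r A = (SOME x. x \<in> A)" for A :: "'a set"
  have r: "r A \<in> A" if "A \<in> P" for A
  proof -
    have "A \<noteq> {}" using P(2) that by (auto simp: partition_on_def)
    then show ?thesis unfolding r_def by (simp add: some_in_eq)
  qed
  \<comment> \<open>The value of \<open>h\<close> on a pair of cells, read off at representatives.
    The remaining coordinates are arbitrary, since \<open>merge\<close> reads only \<open>a\<close>
    and \<open>b\<close>.\<close>
  define c where "c A B = h ((\<lambda>_. undefined)(a := r A, b := r B))" for A B
  have eq: "A' = A" if "A' \<in> P" "A \<in> P" "x \<in> A'" "x \<in> A" for A' A x
    using P(2) that by (auto simp: partition_on_def disjoint_def)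
  \<comment> \<open>With \<open>h\<close> replaced by its constants on the cells, the integral can
    be taken term by term.\<close>
  have split: "V (x a, x b) * h x =
      (\<Sum>A\<in>P. \<Sum>B\<in>P. c A B * (indicat_real (A \<times> B) (x a, x b) * V (x a, x b)))"
    if x: "x \<in> space (PiM I (\<lambda>_. M))" for x
  proof -
    have "(x a, x b) \<in> space (M \<Otimes>\<^sub>M M)"
      using x by (auto simp: space_PiM space_pair_measure I_def)
    then obtain A B where AB: "A \<in> P" "B \<in> P" "(x a, x b) \<in> A \<times> B"
      by (rule partition_on_square_cell[OF P(2)])
    then have hx: "h x = c A B"
      unfolding c_def using r ab by (intro h_cell[of A B]) auto
    have ind: "indicat_real (A' \<times> B') (x a, x b) = (if A' = A then if B' = B then 1 else 0 else 0)"
      if "A' \<in> P" "B' \<in> P" for A' B'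
      using that eq[OF _ AB(1)] eq[OF _ AB(2)] AB(3) by (auto simp: indicator_def)
    have "(\<Sum>A'\<in>P. \<Sum>B'\<in>P. c A' B' * (indicat_real (A' \<times> B') (x a, x b) * V (x a, x b))) =
        (\<Sum>A'\<in>P. if A' = A then \<Sum>B'\<in>P. if B' = B then c A B * V (x a, x b) else 0 else 0)"
      by (intro sum.cong refl) (auto simp: ind intro!: sum.cong)
    also have "\<dots> = c A B * V (x a, x b)" using P(1) AB by simp
    finally show ?thesis by (simp add: hx)
  qed
  have meas: "(\<lambda>x. (x a, x b)) \<in> measurable (PiM I (\<lambda>_. M)) (M \<Otimes>\<^sub>M M)"
    by (intro measurable_Pair measurable_component_singleton) (auto simp: I_def)
  have D: "distr (PiM I (\<lambda>_. M)) (M \<Otimes>\<^sub>M M) (\<lambda>x. (x a, x b)) = M \<Otimes>\<^sub>M M"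
    using ab by (intro distr_PiM_pair) (auto simp: I_def)
  have summand: "integrable (PiM I (\<lambda>_. M)) (\<lambda>x. indicat_real (A \<times> B) (x a, x b) * V (x a, x b))"
    "(\<integral>x. indicat_real (A \<times> B) (x a, x b) * V (x a, x b) \<partial>PiM I (\<lambda>_. M)) = 0"
    if AB: "A \<in> P" "B \<in> P" for A B
  proof -
    have S: "A \<times> B \<in> sets (M \<Otimes>\<^sub>M M)" using AB P(3) by auto
    have int: "integrable (M \<Otimes>\<^sub>M M) (\<lambda>z. indicat_real (A \<times> B) z * V z)"
      using kernel_set_integrable[OF V S] by (simp add: set_integrable_def)
    show "integrable (PiM I (\<lambda>_. M)) (\<lambda>x. indicat_real (A \<times> B) (x a, x b) * V (x a, x b))"
      using int by (intro integrable_distr[OF meas]) (simp add: D)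
    have "(\<integral>x. indicat_real (A \<times> B) (x a, x b) * V (x a, x b) \<partial>PiM I (\<lambda>_. M)) =
        (\<integral>z. indicat_real (A \<times> B) z * V z \<partial>distr (PiM I (\<lambda>_. M)) (M \<Otimes>\<^sub>M M) (\<lambda>x. (x a, x b)))"
      using int by (intro integral_distr[symmetric] meas) auto
    also have "\<dots> = 0"
      unfolding D using V_cell[OF AB] by (simp add: set_lebesgue_integral_def)
    finally show "(\<integral>x. indicat_real (A \<times> B) (x a, x b) * V (x a, x b) \<partial>PiM I (\<lambda>_. M)) = 0" .
  qed
  have "mixed U V {e} = (\<integral>x. (\<Sum>A\<in>P. \<Sum>B\<in>P. c A B * (indicat_real (A \<times> B) (x a, x b) * V (x a, x b)))
      \<partial>PiM I (\<lambda>_. M))"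
    unfolding fold by (intro Bochner_Integration.integral_cong refl split)
  also have "\<dots> = (\<Sum>A\<in>P. \<Sum>B\<in>P. c A B * (\<integral>x. indicat_real (A \<times> B) (x a, x b) * V (x a, x b)
      \<partial>PiM I (\<lambda>_. M)))"
    using summand(1) by (simp add: Bochner_Integration.integral_sum)
  also have "\<dots> = 0" using summand(2) by simp
  finally show ?thesis .
qed

text \<open>The linear coefficient vanishes, and convexity of the norm and of the power gives the
  chord inequality. The form with a general \<open>V\<close> allows the application to every
  multiple \<open>t V\<close>.\<close>

lemma dens_le_cell_averages_zero:
  assumes P: "finite P" "partition_on (space M) P" "P \<subseteq> sets M"
    and U: "graphon M U"
    and U_cell: "\<And>A B z z'. A \<in> P \<Longrightarrow> B \<in> P \<Longrightarrow> z \<in> A \<times> B \<Longrightarrow> z' \<in> A \<times> B \<Longrightarrow> U z = U z'"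
    and V: "kernel M V" and UV: "graphon M (\<lambda>z. U z + V z)"
    and V_cell: "\<And>A B. A \<in> P \<Longrightarrow> B \<in> P \<Longrightarrow> set_lebesgue_integral (M \<Otimes>\<^sub>M M) (A \<times> B) V = 0"
  shows "dens U \<le> dens (\<lambda>z. U z + V z)"
proof -
  note ker = graphon_kernel[OF U]
  have "coefficient U V 0 \<le> dens (\<lambda>z. U z + V z)"
  proof (rule chord_end_ge_if_slope_zero)
    show "coefficient U V 1 = 0"
      by (intro coefficient_1 mixed_cell_averages_zero[OF P ker U_cell V V_cell])
    fix t :: real assume t: "0 \<le> t" "t \<le> 1"
    have "(\<Sum>j\<le>card E. coefficient U V j * t ^ j) = gnorm (\<lambda>z. U z + t * V z) ^ card E"
      using dens_graphon[OF graphon_segment[OF U UV t V]] dens_line[OF ker V] by simp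
    also have "\<dots> \<le> ((1 - t) * gnorm U + t * gnorm (\<lambda>z. U z + V z)) ^ card E"
      by (intro power_mono gnorm_nonneg gnorm_convex ker V t)
    also have "\<dots> \<le> (1 - t) * gnorm U ^ card E + t * gnorm (\<lambda>z. U z + V z) ^ card E"
      by (intro power_convex_combination gnorm_nonneg t)
    finally show "(\<Sum>j\<le>card E. coefficient U V j * t ^ j) \<le>
        (1 - t) * coefficient U V 0 + t * dens (\<lambda>z. U z + V z)"
      by (simp add: coefficient_0 dens_graphon U UV)
  qed (rule card_edges_pos)
  then show ?thesis by (simp add: coefficient_0)
qed

lemma step_forcing_dens: "step_forcing M n E"
  unfolding step_forcing_def
proof (intro allI impI)
  fix W P assume W: "graphon M W" and P: "finite P" "partition_on (space M) P" "P \<subseteq> sets M"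
    and ne: "\<not> (AE z in M \<Otimes>\<^sub>M M. W z = stepping M P W z)"
  define U where "U = stepping M P W"
  define V where "V z = W z - U z" for z
  have U: "graphon M U" unfolding U_def by (rule graphon_stepping[OF W P])
  note ker = graphon_kernel[OF U] graphon_kernel[OF W]
  have V: "kernel M V" unfolding V_def by (intro kernel_diff ker)
  have UV: "(\<lambda>z. U z + V z) = W" by (simp add: V_def)
  have U_cell: "U z = U z'" if "A \<in> P" "B \<in> P" "z \<in> A \<times> B" "z' \<in> A \<times> B" for A B z z'
    unfolding U_def using that stepping_on_cell[OF P(2,1)] by metis
  have V_cell: "set_lebesgue_integral (M \<Otimes>\<^sub>M M) (A \<times> B) V = 0" if "A \<in> P" "B \<in> P" for A B
  proof -
    have "A \<times> B \<in> sets (M \<Otimes>\<^sub>M M)" using that P(3) by auto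
    then have "set_lebesgue_integral (M \<Otimes>\<^sub>M M) (A \<times> B) V =
        set_lebesgue_integral (M \<Otimes>\<^sub>M M) (A \<times> B) W - set_lebesgue_integral (M \<Otimes>\<^sub>M M) (A \<times> B) U"
      unfolding V_def by (intro set_integral_diff kernel_set_integrable ker)
    then show ?thesis using set_integral_stepping[OF W P that] by (simp add: U_def)
  qed
  show "dens (stepping M P W) < dens W"
    unfolding U_def[symmetric]
  proof (rule ccontr)
    assume "\<not> dens U < dens W"
    then have "gnorm W \<le> gnorm U"
      using card_edges_pos power_mono_iff[OF gnorm_nonneg gnorm_nonneg]
      by (simp add: dens_graphon U W not_less)
    \<comment> \<open>Convexity and \<open>gnorm W \<le> gnorm U\<close> bound the density on the
      segment from above; the minimality of \<open>U\<close> bounds it from below.\<close>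
    have const: "dens (\<lambda>z. U z + t * V z) = dens U" if t: "0 \<le> t" "t \<le> 1" for t
    proof (rule antisym)
      have X: "graphon M (\<lambda>z. U z + t * V z)"
        using U W t by (intro graphon_segment V) (simp_all add: UV)
      have "gnorm (\<lambda>z. U z + t * V z) \<le> (1 - t) * gnorm U + t * gnorm W"
        using gnorm_convex[OF ker(1) V t] by (simp add: UV)
      also have "\<dots> \<le> (1 - t) * gnorm U + t * gnorm U"
        using t \<open>gnorm W \<le> gnorm U\<close> by (intro add_left_mono mult_left_mono) auto
      finally show "dens (\<lambda>z. U z + t * V z) \<le> dens U"
        unfolding dens_graphon[OF X] dens_graphon[OF U]
        by (intro power_mono gnorm_nonneg) (simp add: algebra_simps)
      show "dens U \<le> dens (\<lambda>z. U z + t * V z)"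
        by (intro dens_le_cell_averages_zero[OF P U U_cell kernel_scale[OF V] X])
          (simp_all add: V_cell)
    qed
    \<comment> \<open>The limit statement is applied to a constant sequence: a constant polynomial
      has top coefficient 0.\<close>
    have "(\<lambda>k::nat. gnorm V) \<longlonglongrightarrow> 0"
      by (rule gnorm_null_if_dens_tendsto_on_segments[OF ker(1) V]) (simp add: const)
    then have "gnorm V = 0" by (simp add: LIMSEQ_const_iff)
    then have "AE z in M \<Otimes>\<^sub>M M. V z = 0" using gnorm_eq_0[OF V] by simp
    then have "AE z in M \<Otimes>\<^sub>M M. W z = stepping M P W z"
      by (simp add: V_def U_def)
    with ne show False by simp
  qed
qed

end

theorem theorem3p28:
  fixes M :: "'a measure" and n :: nat and E :: "nat set set"
  assumes "standard_borel M" and "prob_space M" and "atomless M"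
    and "simple_graph n E"
    and "norming M n E"
  shows "cut_distance_identifying M (hom_density M n E) \<and> step_forcing M n E"
proof -
  interpret norming_graph M n E
    using assms by (simp add: norming_graph_def norming_graph_axioms_def)
  show ?thesis using cut_distance_identifying_dens step_forcing_dens by blast
qed

end
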